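(* The following decision problem is in $\Pi^p_2$: given two (finite, ground) LPMLN programs $P$ and $Q$, decide whether $P$ and $Q$ are semi-uniformly equivalent.
   Context: A literal is an atom $a$ or its classical negation $\neg a$. An ASP rule $r$ has the form $l_1\vee\cdots\vee l_k\leftarrow l_{k+1},\dots,l_m,\ not\ l_{m+1},\dots,\ not\ l_n$ with literals $l_i$; $h(r)$, $b^+(r)$, $b^-(r)$ are the head, positive body and negative body literal sets; $r$ is a fact if $b^+(r)=b^-(r)=\emptyset$. An interpretation is a set of literals not containing both $a$ and $\neg a$ for any atom $a$. $I\models r$ iff ($b^+(r)\subseteq I$ and $b^-(r)\cap I=\emptyset$) implies $h(r)\cap I\neq\emptyset$. For an ASP program $\Pi$ the GL-reduct is $\Pi^I=\{h(r)\leftarrow b^+(r) : r\in\Pi,\ b^-(r)\cap I=\emptyset\}$, and $I$ is a stable model of $\Pi$ iff $I\models\Pi^I$ and no proper subset of $I$ satisfies $\Pi^I$. An LPMLN program $P$ is a finite set of weighted rules $w:r$, $r$ an ASP rule, $w$ a real number or the symbol $\alpha$; a weighted fact is $w:r$ with $r$ a fact; $\overline{P}=\{r: w:r\in P\}$. $P_I=\{w:r\in P : I\models r\}$; $I$ is a stable model of $P$ iff it is a stable model of $\overline{P_I}$; $\mathrm{SM}(P)$ is the set of stable models. $P,Q$ are semi-uniformly equivalent iff $\mathrm{SM}(P\cup R)=\mathrm{SM}(Q\cup R)$ for every finite set $R$ of weighted facts. *)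

theory Defs
  imports Complex_Main "HOL-Computational_Algebra.Polynomial"
begin

section \<open>ASP and LPMLN programs\<close>

datatype 'a literal = Pos 'a | Neg 'a

text \<open>
  \<open>Rule hs ps ns\<close> is the rule with head \<open>hs\<close> (a disjunction, possibly empty), positive body \<open>ps\<close>
  and default-negated body \<open>ns\<close>.  Keeping the literals in lists makes every rule finite.
\<close>

datatype 'a rule = Rule (head_lits: "'a literal list") (pos_lits: "'a literal list")
  (neg_lits: "'a literal list")

definition head :: "'a rule \<Rightarrow> 'a literal set" where
  "head r = set (head_lits r)"

definition pos_body :: "'a rule \<Rightarrow> 'a literal set" where
  "pos_body r = set (pos_lits r)"

definition neg_body :: "'a rule \<Rightarrow> 'a literal set" where
  "neg_body r = set (neg_lits r)"

definition is_fact :: "'a rule \<Rightarrow> bool" where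
  "is_fact r \<longleftrightarrow> pos_body r = {} \<and> neg_body r = {}"

definition interpretation_lits :: "'a literal set \<Rightarrow> bool" where
  "interpretation_lits I \<longleftrightarrow> (\<forall>a. \<not> (Pos a \<in> I \<and> Neg a \<in> I))"

definition sat_rule :: "'a literal set \<Rightarrow> 'a rule \<Rightarrow> bool" where
  "sat_rule I r \<longleftrightarrow>
     (pos_body r \<subseteq> I \<and> neg_body r \<inter> I = {} \<longrightarrow> head r \<inter> I \<noteq> {})"

definition sat_prog :: "'a literal set \<Rightarrow> 'a rule set \<Rightarrow> bool" where
  "sat_prog I \<Pi> \<longleftrightarrow> (\<forall>r\<in>\<Pi>. sat_rule I r)"

definition gl_reduct :: "'a rule set \<Rightarrow> 'a literal set \<Rightarrow> 'a rule set" where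
  "gl_reduct \<Pi> I = {Rule (head_lits r) (pos_lits r) [] | r. r \<in> \<Pi> \<and> neg_body r \<inter> I = {}}"

definition asp_stable :: "'a rule set \<Rightarrow> 'a literal set \<Rightarrow> bool" where
  "asp_stable \<Pi> I \<longleftrightarrow> interpretation_lits I \<and> sat_prog I (gl_reduct \<Pi> I) \<and>
     (\<forall>J. J \<subset> I \<longrightarrow> \<not> sat_prog J (gl_reduct \<Pi> I))"

text \<open>
  \<open>Alpha\<close> is the symbol \<open>\<alpha>\<close> of hard rules.  The weights of LPMLN programs are in \<open>real weight\<close>;
  the type parameter is needed below, where the weights of input programs are given by words.
\<close>

datatype 'w weight = Alpha | Soft 'w

type_synonym 'a lpmln = "(real weight \<times> 'a rule) set"

definition unweighted :: "'a lpmln \<Rightarrow> 'a rule set" where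
  "unweighted P = {r. \<exists>w. (w, r) \<in> P}"

definition sat_part :: "'a lpmln \<Rightarrow> 'a literal set \<Rightarrow> 'a lpmln" where
  "sat_part P I = {(w, r) \<in> P. sat_rule I r}"

definition SM :: "'a lpmln \<Rightarrow> 'a literal set set" where
  "SM P = {I. asp_stable (unweighted (sat_part P I)) I}"

definition weighted_facts :: "'a lpmln \<Rightarrow> bool" where
  "weighted_facts R \<longleftrightarrow> (\<forall>(w, r)\<in>R. is_fact r)"

definition semi_uniformly_equivalent :: "'a lpmln \<Rightarrow> 'a lpmln \<Rightarrow> bool" where
  "semi_uniformly_equivalent P Q \<longleftrightarrow>
     (\<forall>R. finite R \<and> weighted_facts R \<longrightarrow> SM (P \<union> R) = SM (Q \<union> R))"


section \<open>Deterministic multi-tape Turing machines\<close>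

text \<open>
  States and tape symbols are initial segments of the natural numbers.  Symbol \<open>0\<close> is the blank,
  and \<open>1\<close> and \<open>2\<close> are the input symbols for \<^const>\<open>False\<close> and \<^const>\<open>True\<close>.
\<close>

datatype dir = Move_Left | Stay | Move_Right

record tm =
  num_tapes :: nat
  num_symbols :: nat
  num_states :: nat
  start :: nat
  accept :: nat
  reject :: nat
  delta :: "nat \<Rightarrow> nat list \<Rightarrow> nat \<times> (nat \<times> dir) list"

text \<open>
  Only the finitely many values of \<^const>\<open>delta\<close> at states and tuples of symbols of the machine
  matter for its runs.
\<close>

definition tm_wf :: "tm \<Rightarrow> bool" where
  "tm_wf M \<longleftrightarrow>
     num_tapes M \<ge> 1 \<and> num_symbols M \<ge> 3 \<and>
     start M < num_states M \<and> accept M < num_states M \<and> reject M < num_states M \<and>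
     accept M \<noteq> reject M \<and>
     (\<forall>q < num_states M. \<forall>ss. length ss = num_tapes M \<and> set ss \<subseteq> {..<num_symbols M} \<longrightarrow>
        (case delta M q ss of (q', as) \<Rightarrow>
           q' < num_states M \<and> length as = num_tapes M \<and>
           (\<forall>(s, d)\<in>set as. s < num_symbols M)))"

text \<open>A tape is two-way infinite and comes with the position of its head.\<close>

type_synonym tape = "int \<times> (int \<Rightarrow> nat)"
type_synonym config = "nat \<times> tape list"

definition read_tape :: "tape \<Rightarrow> nat" where
  "read_tape T = snd T (fst T)"

fun dir_offset :: "dir \<Rightarrow> int" where
  "dir_offset Move_Left = -1"
| "dir_offset Stay = 0"
| "dir_offset Move_Right = 1"

fun act :: "nat \<times> dir \<Rightarrow> tape \<Rightarrow> tape" where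
  "act (s, d) (h, f) = (h + dir_offset d, f(h := s))"

definition step :: "tm \<Rightarrow> config \<Rightarrow> config" where
  "step M c = (case c of (q, Ts) \<Rightarrow>
     if q = accept M \<or> q = reject M then (q, Ts)
     else (case delta M q (map read_tape Ts) of (q', as) \<Rightarrow> (q', map2 act as Ts)))"

definition blank_tape :: tape where
  "blank_tape = (0, \<lambda>i. 0)"

definition input_tape :: "bool list \<Rightarrow> tape" where
  "input_tape x =
     (0, \<lambda>i. if 0 \<le> i \<and> i < int (length x) then (if x ! nat i then 2 else 1) else 0)"

definition init_config :: "tm \<Rightarrow> bool list \<Rightarrow> config" where
  "init_config M x = (start M, input_tape x # replicate (num_tapes M - 1) blank_tape)"

definition state_after :: "tm \<Rightarrow> bool list \<Rightarrow> nat \<Rightarrow> nat" where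
  "state_after M x t = fst ((step M ^^ t) (init_config M x))"

definition decides_in_time :: "tm \<Rightarrow> bool list set \<Rightarrow> (nat \<Rightarrow> nat) \<Rightarrow> bool" where
  "decides_in_time M L T \<longleftrightarrow>
     (\<forall>x. \<exists>t \<le> T (length x). state_after M x t = (if x \<in> L then accept M else reject M))"


section \<open>Complexity classes\<close>

definition PTIME :: "bool list set set" where
  "PTIME = {L. \<exists>M. \<exists>p :: nat poly. tm_wf M \<and> decides_in_time M L (poly p)}"

text \<open>
  \<open>enc_list f\<close> is a self-delimiting code of lists: every element is announced by \<^const>\<open>True\<close>, and
  the end of the list by \<^const>\<open>False\<close>.
\<close>

definition enc_list :: "('b \<Rightarrow> bool list) \<Rightarrow> 'b list \<Rightarrow> bool list" where
  "enc_list f xs = concat (map (\<lambda>x. True # f x) xs) @ [False]"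

definition enc_word :: "bool list \<Rightarrow> bool list" where
  "enc_word = enc_list (\<lambda>b. [b])"

definition enc_triple :: "bool list \<Rightarrow> bool list \<Rightarrow> bool list \<Rightarrow> bool list" where
  "enc_triple x y z = enc_word x @ enc_word y @ enc_word z"

definition SigmaP2 :: "bool list set set" where
  "SigmaP2 = {L. \<exists>V \<in> PTIME. \<exists>q :: nat poly. \<forall>x. x \<in> L \<longleftrightarrow>
     (\<exists>y. length y \<le> poly q (length x) \<and>
       (\<forall>z. length z \<le> poly q (length x) \<longrightarrow> enc_triple x y z \<in> V))}"

definition PiP2 :: "bool list set set" where
  "PiP2 = {L. - L \<in> SigmaP2}"


section \<open>The decision problem\<close>

text \<open>
  An input program is a list of weighted rules whose atoms are named by words.  A real number has
  to be given by a finite name as well; \<open>val\<close> says which real number a word denotes.  No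
  assumption on \<open>val\<close> is made, so it can be any notation for rationals, algebraic numbers, etc.
\<close>

type_synonym atom = "bool list"
type_synonym input_prog = "(bool list weight \<times> atom rule) list"

definition prog_of :: "(bool list \<Rightarrow> real) \<Rightarrow> input_prog \<Rightarrow> atom lpmln" where
  "prog_of val p = {(map_weight val w, r) | w r. (w, r) \<in> set p}"

fun enc_literal :: "atom literal \<Rightarrow> bool list" where
  "enc_literal (Pos a) = True # enc_word a"
| "enc_literal (Neg a) = False # enc_word a"

fun enc_rule :: "atom rule \<Rightarrow> bool list" where
  "enc_rule (Rule hs ps ns) =
     enc_list enc_literal hs @ enc_list enc_literal ps @ enc_list enc_literal ns"

fun enc_weight :: "bool list weight \<Rightarrow> bool list" where
  "enc_weight Alpha = [False]"
| "enc_weight (Soft w) = True # enc_word w"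

fun enc_wrule :: "bool list weight \<times> atom rule \<Rightarrow> bool list" where
  "enc_wrule (w, r) = enc_weight w @ enc_rule r"

definition enc_instance :: "input_prog \<Rightarrow> input_prog \<Rightarrow> bool list" where
  "enc_instance p q = enc_list enc_wrule p @ enc_list enc_wrule q"

definition semi_uniform_equivalence_problem :: "(bool list \<Rightarrow> real) \<Rightarrow> bool list set" where
  "semi_uniform_equivalence_problem val =
     {enc_instance p q | p q. semi_uniformly_equivalent (prog_of val p) (prog_of val q)}"


subsection \<open>Every finite program can be an input\<close>

lemma ex_input_prog:
  fixes P :: "atom lpmln"
  assumes "finite P" and "{c. \<exists>r. (Soft c, r) \<in> P} \<subseteq> range val"
  shows "\<exists>p. prog_of val p = P"
proof -
  have "\<exists>w. map_weight val w = v" if "(v, r) \<in> P" for v r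
  proof (cases v)
    case Alpha
    then have "map_weight val Alpha = v" by simp
    then show ?thesis ..
  next
    case (Soft c)
    then obtain w where "c = val w" using assms(2) \<open>(v, r) \<in> P\<close> by blast
    with Soft have "map_weight val (Soft w) = v" by simp
    then show ?thesis ..
  qed
  then have name: "map_weight val (SOME w. map_weight val w = v) = v" if "(v, r) \<in> P" for v r
    using that by (rule_tac someI_ex)
  obtain vs where vs: "set vs = P" using finite_list[OF assms(1)] ..
  let ?f = "\<lambda>(v, r). (SOME w. map_weight val w = v, r)"
  let ?g = "\<lambda>(w, r). (map_weight val w, r)"
  have "prog_of val (map ?f vs) = ?g ` ?f ` P"
    unfolding prog_of_def set_map vs by fast
  also have "\<dots> = (\<lambda>x. ?g (?f x)) ` P" by (rule image_image)
  also have "\<dots> = (\<lambda>x. x) ` P"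
    by (rule image_cong) (use name in auto)
  finally show ?thesis by auto
qed

lemma ex_val_input_progs:
  fixes P Q :: "atom lpmln"
  assumes "finite P" and "finite Q"
  shows "\<exists>val p q. prog_of val p = P \<and> prog_of val q = Q"
proof -
  let ?C = "{c. \<exists>r. (Soft c, r) \<in> P \<union> Q}"
  have "Soft ` ?C \<subseteq> fst ` (P \<union> Q)" by force
  then have "finite (Soft ` ?C)"
    using assms by (meson finite_UnI finite_imageI finite_subset)
  then have "finite ?C" by (rule finite_imageD) (simp add: inj_on_def)
  from finite_list[OF this] obtain cs where cs: "set cs = ?C" ..
  define val where "val = (\<lambda>w :: bool list. cs ! length w)"
  have "c \<in> range val" if c: "c \<in> ?C" for c
  proof -
    obtain i where "cs ! i = c" using c cs by (metis in_set_conv_nth)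
    then have "c = val (replicate i True)" by (simp add: val_def)
    then show ?thesis by simp
  qed
  then have "{c. \<exists>r. (Soft c, r) \<in> P} \<subseteq> range val" "{c. \<exists>r. (Soft c, r) \<in> Q} \<subseteq> range val"
    by auto
  then obtain p q where "prog_of val p = P" "prog_of val q = Q"
    using ex_input_prog[OF assms(1)] ex_input_prog[OF assms(2)] by metis
  then show ?thesis by (intro exI conjI)
qed


subsection \<open>Unique readability of the encodings\<close>

definition self_delimiting :: "('b \<Rightarrow> bool list) \<Rightarrow> bool" where
  "self_delimiting f \<longleftrightarrow> (\<forall>x y u v. f x @ u = f y @ v \<longrightarrow> x = y \<and> u = v)"

lemma self_delimitingD: "self_delimiting f \<Longrightarrow> f x @ u = f y @ v \<Longrightarrow> x = y \<and> u = v"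
  unfolding self_delimiting_def by blast

lemma self_delimiting_iff: "self_delimiting f \<Longrightarrow> f x @ u = f y @ v \<longleftrightarrow> x = y \<and> u = v"
  unfolding self_delimiting_def by blast

lemma self_delimiting_enc_list:
  assumes "self_delimiting f"
  shows "self_delimiting (enc_list f)"
proof -
  have "xs = ys \<and> u = v" if "enc_list f xs @ u = enc_list f ys @ v" for xs ys u v
    using that
  proof (induction xs arbitrary: ys)
    case Nil
    then show ?case by (cases ys) (auto simp: enc_list_def)
  next
    case (Cons x xs)
    then show ?case
      by (cases ys) (auto simp: enc_list_def dest!: self_delimitingD[OF assms])
  qed
  then show ?thesis unfolding self_delimiting_def by blast
qed

lemma self_delimiting_enc_word: "self_delimiting enc_word"
  unfolding enc_word_def
  by (rule self_delimiting_enc_list) (simp add: self_delimiting_def)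

lemma enc_triple_inject:
  "enc_triple x y z = enc_triple x' y' z' \<longleftrightarrow> x = x' \<and> y = y' \<and> z = z'"
proof -
  note sd = self_delimiting_iff[OF self_delimiting_enc_word]
  show ?thesis
    using sd[of z "[]" z' "[]"] by (simp add: enc_triple_def sd)
qed

lemma self_delimiting_enc_literal: "self_delimiting enc_literal"
proof -
  have "l = l' \<and> u = v" if "enc_literal l @ u = enc_literal l' @ v" for l l' u v
    using that
    by (cases l; cases l') (auto dest: self_delimitingD[OF self_delimiting_enc_word])
  then show ?thesis unfolding self_delimiting_def by blast
qed

lemma self_delimiting_enc_rule: "self_delimiting enc_rule"
proof -
  note sd = self_delimitingD[OF self_delimiting_enc_list[OF self_delimiting_enc_literal]]
  have "r = r' \<and> u = v" if "enc_rule r @ u = enc_rule r' @ v" for r r' u v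
    using that by (cases r; cases r') (auto dest!: sd)
  then show ?thesis unfolding self_delimiting_def by blast
qed

lemma self_delimiting_enc_wrule: "self_delimiting enc_wrule"
proof -
  have w: "w = w' \<and> u = v" if "enc_weight w @ u = enc_weight w' @ v" for w w' u v
    using that
    by (cases w; cases w') (auto dest: self_delimitingD[OF self_delimiting_enc_word])
  have "a = b \<and> u = v" if "enc_wrule a @ u = enc_wrule b @ v" for a b u v
    using that
    by (cases a; cases b) (auto dest!: w self_delimitingD[OF self_delimiting_enc_rule])
  then show ?thesis unfolding self_delimiting_def by blast
qed

lemma enc_instance_inject:
  "enc_instance p q = enc_instance p' q' \<longleftrightarrow> p = p' \<and> q = q'"
proof -
  note sd = self_delimiting_iff[OF self_delimiting_enc_list[OF self_delimiting_enc_wrule]]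
  show ?thesis
    using sd[of q "[]" q' "[]"] by (simp add: enc_instance_def sd)
qed

end

theory Submission
  imports Defs
begin

text \<open>
  If \<open>P\<close> and \<open>Q\<close> are not semi-uniformly equivalent, this is witnessed by sets \<open>J \<subset> I\<close> of literals of
  the programs: up to exchanging \<open>P\<close> and \<open>Q\<close>, \<open>J\<close> satisfies the reduct of \<open>Q\<^sub>I\<close>, and no \<open>K\<close> with
  \<open>J \<subseteq> K \<subset> I\<close> satisfies the reduct of \<open>P\<^sub>I\<close>; then adding the elements of \<open>J\<close> as facts separates the
  two programs, and disjunctive facts separate no more.  So the complement of the problem has the
  form \<open>\<exists>I J. \<forall>K\<close>.

  The sets are given by labels of the input word, one for each occurrence of a literal.  What has to
  be known about the labelled programs is computed by a finite automaton, and as the run of a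
  deterministic automaton is unique, it can be guessed universally together with \<open>K\<close>.  It remains
  to check that this run is correct and that equal literals have equal labels.  This is expressible
  in first-order logic with addition of positions, and a formula of that logic is evaluated in
  polynomial time by a Turing machine with one tape for each variable.
\<close>


section \<open>Structured programs for Turing machines\<close>

text \<open>Membership in \<open>PTIME\<close> asks for a concrete machine. Only one kind is built,
  the evaluator of a formula; everything specific to the problem is put into the formula. The
  formula is fixed, so the number of tapes and the nesting of loops, hence the degree of the time
  bound, do not depend on the input. Following the automaton along a word is left to the guess of
  its run, because the correctness of a given run is a local condition. The automaton can be finite
  because a rule matters only through the labels that occur in each of its parts: satisfaction of a
  reduct can be read off these, and three bits per literal leave finitely many possibilities. Labels
  belong to occurrences because a word carries no table of its literals; the price is the comparison
  of atoms. The two kinds of guesses are treated differently: a wrong run or an inconsistent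
  \<open>K\<close> makes the condition vacuously true, whereas inconsistent \<open>I\<close> and
  \<open>J\<close>, being chosen existentially, must be refuted.\<close>

text \<open>
  \<open>Prim f\<close> is a single step.  A program ends with a result in \<open>bool option\<close>; the result \<open>None\<close> makes
  the innermost loop start again.  In \<open>Loop p\<^sub>0 p\<close>, \<open>p\<close> is what remains of the current iteration of
  the body \<open>p\<^sub>0\<close>.  In this way the control state is itself a program, and as only finitely many
  programs arise during an execution, they serve as the states of a Turing machine.
\<close>

datatype prog =
    Prim "nat list \<Rightarrow> bool option \<times> (nat \<times> dir) list"
  | Branch prog prog prog
  | Loop prog prog

primrec pstep :: "prog \<Rightarrow> nat list \<Rightarrow> (prog + bool option) \<times> (nat \<times> dir) list" where
  "pstep (Prim f) ss = (Inr (fst (f ss)), snd (f ss))"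
| "pstep (Branch p q r) ss =
     (case pstep p ss of (v, as) \<Rightarrow>
       (case v of
          Inl p' \<Rightarrow> Inl (Branch p' q r)
        | Inr None \<Rightarrow> Inr None
        | Inr (Some b) \<Rightarrow> Inl (if b then q else r), as))"
| "pstep (Loop p\<^sub>0 p) ss =
     (case pstep p ss of (v, as) \<Rightarrow>
       (case v of
          Inl p' \<Rightarrow> Inl (Loop p\<^sub>0 p')
        | Inr None \<Rightarrow> Inl (Loop p\<^sub>0 p\<^sub>0)
        | Inr (Some b) \<Rightarrow> Inr (Some b), as))"

text \<open>In \<open>runs p Ts t v Ts'\<close>, the number \<open>t\<close> is only an upper bound of the running time.\<close>

inductive runs :: "prog \<Rightarrow> tape list \<Rightarrow> nat \<Rightarrow> bool option \<Rightarrow> tape list \<Rightarrow> bool" where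
  halt: "pstep p (map read_tape Ts) = (Inr v, as) \<Longrightarrow> runs p Ts (Suc t) v (map2 act as Ts)"
| continue: "pstep p (map read_tape Ts) = (Inl p', as) \<Longrightarrow> runs p' (map2 act as Ts) t v Ts' \<Longrightarrow>
    runs p Ts (Suc t) v Ts'"

lemma runs_mono: "runs p Ts t v Ts' \<Longrightarrow> t \<le> t' \<Longrightarrow> runs p Ts t' v Ts'"
proof (induction arbitrary: t' rule: runs.induct)
  case (halt p Ts v as t)
  then show ?case by (cases t') (auto intro: runs.halt)
next
  case (continue p Ts p' as t v Ts')
  then obtain u where u: "t' = Suc u" "t \<le> u" by (cases t') auto
  show ?case unfolding u(1) by (rule runs.continue[OF continue.hyps(1) continue.IH[OF u(2)]])
qed

lemma runs_Branch:
  "runs p Ts t (Some b) Ts' \<Longrightarrow> runs (if b then q else r) Ts' t' v Ts'' \<Longrightarrow>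
   runs (Branch p q r) Ts (t + t') v Ts''"
proof (induction p Ts t "Some b" Ts' rule: runs.induct)
  case (halt p Ts as t)
  from halt.hyps have "pstep (Branch p q r) (map read_tape Ts) = (Inl (if b then q else r), as)"
    by simp
  \<comment> \<open>The step that ends \<open>p\<close> already enters the chosen branch, so
    \<open>Suc t'\<close> steps are enough.\<close>
  from runs.continue[OF this halt.prems] show ?case by (rule runs_mono) simp
next
  case (continue p Ts p' as t Ts')
  from continue.hyps(1) have "pstep (Branch p q r) (map read_tape Ts) = (Inl (Branch p' q r), as)"
    by simp
  from runs.continue[OF this continue.hyps(3)[OF continue.prems]] show ?case by simp
qed

lemma runs_Loop_exit:
  "runs p Ts t (Some b) Ts' \<Longrightarrow> runs (Loop p\<^sub>0 p) Ts t (Some b) Ts'"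
proof (induction p Ts t "Some b" Ts' rule: runs.induct)
  case (halt p Ts as t)
  then show ?case by (intro runs.halt) simp
next
  case (continue p Ts p' as t Ts')
  from continue.hyps(1) have "pstep (Loop p\<^sub>0 p) (map read_tape Ts) = (Inl (Loop p\<^sub>0 p'), as)"
    by simp
  from runs.continue[OF this continue.hyps(3)] show ?case .
qed

lemma runs_Loop_again:
  "runs p Ts t None Ts' \<Longrightarrow> runs (Loop p\<^sub>0 p\<^sub>0) Ts' t' v Ts'' \<Longrightarrow> runs (Loop p\<^sub>0 p) Ts (t + t') v Ts''"
proof (induction p Ts t "None :: bool option" Ts' rule: runs.induct)
  case (halt p Ts as t)
  from halt.hyps have "pstep (Loop p\<^sub>0 p) (map read_tape Ts) = (Inl (Loop p\<^sub>0 p\<^sub>0), as)"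
    by simp
  from runs.continue[OF this halt.prems] show ?case by (rule runs_mono) simp
next
  case (continue p Ts p' as t Ts')
  from continue.hyps(1) have "pstep (Loop p\<^sub>0 p) (map read_tape Ts) = (Inl (Loop p\<^sub>0 p'), as)"
    by simp
  from runs.continue[OF this continue.hyps(3)[OF continue.prems]] show ?case by simp
qed

section \<open>Translation of programs into Turing machines\<close>

primrec residuals :: "prog \<Rightarrow> prog set" where
  "residuals (Prim f) = {Prim f}"
| "residuals (Branch p q r) = (\<lambda>p'. Branch p' q r) ` residuals p \<union> residuals q \<union> residuals r"
| "residuals (Loop p\<^sub>0 p) = Loop p\<^sub>0 ` (residuals p\<^sub>0 \<union> residuals p)"

lemma finite_residuals: "finite (residuals p)"
  by (induction p) auto

lemma self_in_residuals: "p \<in> residuals p"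
  by (induction p) auto

text \<open>The set may be larger than what actually arises from \<open>p\<close>; being finite,
  containing \<open>p\<close> and being closed under steps is what makes it a set of states.\<close>

lemma residuals_pstep:
  "p' \<in> residuals p \<Longrightarrow> pstep p' ss = (Inl p'', as) \<Longrightarrow> p'' \<in> residuals p"
proof (induction p arbitrary: p' p'' as)
  case (Prim f)
  then show ?case by auto
next
  case (Branch p q r)
  from Branch.prems(1) consider a where "p' = Branch a q r" "a \<in> residuals p"
    | "p' \<in> residuals q" | "p' \<in> residuals r" by auto
  then show ?case
  proof cases
    case 1
    obtain v where v: "pstep a ss = (v, as)"
      using Branch.prems(2) 1(1) by (cases "pstep a ss") simp
    show ?thesis
    proof (cases v)
      case (Inl a')
      then show ?thesis using Branch.prems(2) 1 v Branch.IH(1)[OF 1(2)] by auto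
    next
      case (Inr u)
      with Branch.prems(2) 1 v have "p'' = q \<or> p'' = r" by (cases u) (simp_all split: if_splits)
      then show ?thesis using self_in_residuals[of p''] by auto
    qed
  next
    case 2
    then show ?thesis using Branch.prems(2) Branch.IH(2) by simp
  next
    case 3
    then show ?thesis using Branch.prems(2) Branch.IH(3) by simp
  qed
next
  case (Loop p\<^sub>0 p)
  from Loop.prems(1) obtain a where a: "p' = Loop p\<^sub>0 a" "a \<in> residuals p\<^sub>0 \<or> a \<in> residuals p"
    by auto
  obtain v where v: "pstep a ss = (v, as)"
    using Loop.prems(2) a(1) by (cases "pstep a ss") simp
  show ?case
  proof (cases v)
    case (Inl a')
    with Loop.prems(2) a(1) v have "p'' = Loop p\<^sub>0 a'" by simp
    moreover have "a' \<in> residuals p\<^sub>0 \<union> residuals p"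
      using a(2) v[unfolded Inl] Loop.IH by blast
    ultimately show ?thesis by simp
  next
    case (Inr u)
    with Loop.prems(2) a(1) v have "p'' = Loop p\<^sub>0 p\<^sub>0" by (cases u) simp_all
    then show ?thesis using self_in_residuals[of p\<^sub>0] by simp
  qed
qed

text \<open>The five symbols are the blank, the two bits and the end markers 3 and 4.\<close>

primrec wf_prog :: "nat \<Rightarrow> prog \<Rightarrow> bool" where
  "wf_prog K (Prim f) \<longleftrightarrow> (\<forall>ss. length ss = K \<and> set ss \<subseteq> {..<5} \<longrightarrow>
     length (snd (f ss)) = K \<and> fst ` set (snd (f ss)) \<subseteq> {..<5})"
| "wf_prog K (Branch p q r) \<longleftrightarrow> wf_prog K p \<and> wf_prog K q \<and> wf_prog K r"
| "wf_prog K (Loop p\<^sub>0 p) \<longleftrightarrow> wf_prog K p\<^sub>0 \<and> wf_prog K p"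

lemma wf_prog_residuals: "p' \<in> residuals p \<Longrightarrow> wf_prog K p \<Longrightarrow> wf_prog K p'"
proof (induction p arbitrary: p')
  case (Prim f)
  then show ?case by simp
next
  case (Branch p q r)
  from Branch.prems(1) consider a where "p' = Branch a q r" "a \<in> residuals p"
    | "p' \<in> residuals q" | "p' \<in> residuals r" by auto
  then show ?case using Branch.prems(2) Branch.IH by cases simp_all
next
  case (Loop p\<^sub>0 p)
  from Loop.prems(1) obtain a where "p' = Loop p\<^sub>0 a" "a \<in> residuals p\<^sub>0 \<or> a \<in> residuals p"
    by auto
  then show ?case using Loop.prems(2) Loop.IH by auto
qed

lemma wf_prog_pstep:
  assumes "length ss = K" "set ss \<subseteq> {..<5}"
  shows "wf_prog K p \<Longrightarrow> length (snd (pstep p ss)) = K \<and> fst ` set (snd (pstep p ss)) \<subseteq> {..<5}"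
proof (induction p)
  case (Prim f)
  then show ?case using assms by simp
next
  case (Branch p q r)
  then show ?case by (simp add: case_prod_beta)
next
  case (Loop p\<^sub>0 p)
  then show ?case by (simp add: case_prod_beta)
qed

text \<open>The residuals are numbered by \<open>ix\<close>, and \<open>n\<close> and
  \<open>n + 1\<close> are the halting states. A \<open>None\<close> outside of all loops is sent to
  the rejecting state. In the halting states \<open>delta\<close> rewrites what it reads, because
  \<open>tm_wf\<close> asks for a legal value there too.\<close>

definition prog_tm :: "nat \<Rightarrow> prog \<Rightarrow> (prog \<Rightarrow> nat) \<Rightarrow> tm" where
  "prog_tm K p ix =
     (let n = card (residuals p) in
     \<lparr>num_tapes = K, num_symbols = 5, num_states = n + 2, start = ix p, accept = n, reject = n + 1,
      delta = \<lambda>q ss. if q < n then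
          (case pstep (inv_into (residuals p) ix q) ss of (v, as) \<Rightarrow>
            (case v of Inl p' \<Rightarrow> ix p' | Inr u \<Rightarrow> if u = Some True then n else n + 1, as))
        else (q, map (\<lambda>s. (s, Stay)) ss)\<rparr>)"

text \<open>One machine step performs one \<open>pstep\<close>, and the step that ends the program
  is also the one that enters a halting state, so the time bound carries over unchanged.\<close>

lemma PTIME_prog:
  assumes wf: "wf_prog K p" and K: "K \<ge> 1"
    and run: "\<And>x. \<exists>Ts'. runs p (input_tape x # replicate (K - 1) blank_tape)
      (poly T (length x)) (Some (x \<in> L)) Ts'"
  shows "L \<in> PTIME"
proof -
  let ?n = "card (residuals p)"
  obtain ix where ix: "bij_betw ix (residuals p) {0..<?n}"
    using ex_bij_betw_finite_nat[OF finite_residuals] by blast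
  have ix_less: "ix p' < ?n" if "p' \<in> residuals p" for p'
    using bij_betwE[OF ix] that by auto
  have ix_inv: "inv_into (residuals p) ix (ix p') = p'" if "p' \<in> residuals p" for p'
    using ix that by (simp add: bij_betw_def inv_into_f_f)
  have inv_in: "inv_into (residuals p) ix q \<in> residuals p" if "q < ?n" for q
    using ix that by (intro inv_into_into) (simp add: bij_betw_def)
  let ?M = "prog_tm K p ix"
  have M: "num_tapes ?M = K" "num_symbols ?M = 5" "num_states ?M = ?n + 2" "start ?M = ix p"
    "accept ?M = ?n" "reject ?M = ?n + 1"
    by (simp_all add: prog_tm_def Let_def)
  have delta: "delta ?M q ss = (if q < ?n then
          (case pstep (inv_into (residuals p) ix q) ss of (v, as) \<Rightarrow>
            (case v of Inl p' \<Rightarrow> ix p' | Inr u \<Rightarrow> if u = Some True then ?n else ?n + 1, as))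
        else (q, map (\<lambda>s. (s, Stay)) ss))" for q ss
    by (simp add: prog_tm_def Let_def)
  have "tm_wf ?M"
    unfolding tm_wf_def M
  proof (intro conjI allI impI)
    show "1 \<le> K" by (rule K)
    show "ix p < ?n + 2" using ix_less[OF self_in_residuals] by simp
    fix q :: nat and ss :: "nat list"
    assume q: "q < ?n + 2" and ss: "length ss = K \<and> set ss \<subseteq> {..<5}"
    show "case delta ?M q ss of (q', as) \<Rightarrow> q' < ?n + 2 \<and> length as = K \<and> (\<forall>(s, d)\<in>set as. s < 5)"
    proof (cases "q < ?n")
      case True
      obtain v as where st: "pstep (inv_into (residuals p) ix q) ss = (v, as)" by fastforce
      have "length as = K \<and> fst ` set as \<subseteq> {..<5}"
        using wf_prog_pstep[OF _ _ wf_prog_residuals[OF inv_in[OF True] wf], of ss] ss st by simp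
      moreover have "ix p' < ?n + 2" if "v = Inl p'" for p'
        using ix_less[OF residuals_pstep[OF inv_in[OF True]]] st that by (metis trans_less_add1)
      ultimately show ?thesis using True st
        by (auto simp: delta split: sum.splits)
    next
      case False
      then show ?thesis using q ss by (auto simp: delta)
    qed
  qed auto
  moreover have "decides_in_time ?M L (poly T)"
    unfolding decides_in_time_def
  proof
    fix x
    have main: "\<exists>t' \<le> t. fst ((step ?M ^^ t') (ix q, Ts)) = (if b then ?n else ?n + 1)"
      if "runs q Ts t (Some b) Ts'" "q \<in> residuals p" for q Ts t b Ts'
      using that
    proof (induction q Ts t "Some b" Ts' rule: runs.induct)
      case (halt q Ts as t)
      then have "fst ((step ?M ^^ 1) (ix q, Ts)) = (if b then ?n else ?n + 1)"
        using ix_less[of q] by (auto simp: step_def M delta ix_inv)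
      then show ?case by (metis Suc_le_mono le0 One_nat_def)
    next
      case (continue q Ts q' as t Ts')
      have "q' \<in> residuals p" using residuals_pstep continue by blast
      with continue obtain t' where t': "t' \<le> t"
        "fst ((step ?M ^^ t') (ix q', map2 act as Ts)) = (if b then ?n else ?n + 1)" by blast
      have "step ?M (ix q, Ts) = (ix q', map2 act as Ts)"
        using continue ix_less[of q] by (auto simp: step_def M delta ix_inv)
      then have "(step ?M ^^ Suc t') (ix q, Ts) = (step ?M ^^ t') (ix q', map2 act as Ts)"
        by (simp add: funpow_swap1)
      with t' show ?case by (metis Suc_le_mono)
    qed
    obtain Ts' where "runs p (input_tape x # replicate (K - 1) blank_tape)
        (poly T (length x)) (Some (x \<in> L)) Ts'"
      using run by blast
    from main[OF this self_in_residuals]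
    show "\<exists>t \<le> poly T (length x). state_after ?M x t = (if x \<in> L then accept ?M else reject ?M)"
      unfolding state_after_def init_config_def M .
  qed
  ultimately show ?thesis unfolding PTIME_def by blast
qed


section \<open>First-order properties of words in polynomial time\<close>

text \<open>
  All tapes hold the word \<open>w\<close> between the end markers \<open>3\<close> and \<open>4\<close>, and only the heads move.  The head
  of tape \<open>i\<close> is on cell \<open>h i - 1\<close>, so that \<open>h i = 0\<close> and \<open>h i = length w + 1\<close> are the positions of the
  markers.
\<close>

definition marked :: "bool list \<Rightarrow> int \<Rightarrow> nat" where
  "marked w i = (if i = -1 then 3 else if i = int (length w) then 4
     else if 0 \<le> i \<and> i < int (length w) then (if w ! nat i then 2 else 1) else 0)"

definition tapes :: "nat \<Rightarrow> bool list \<Rightarrow> (nat \<Rightarrow> int) \<Rightarrow> tape list" where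
  "tapes K w h = map (\<lambda>i. (h i - 1, marked w)) [0..<K]"

lemma tapes_cong: "(\<And>i. i < K \<Longrightarrow> h i = h' i) \<Longrightarrow> tapes K w h = tapes K w h'"
  by (simp add: tapes_def)

lemma marked_eq_3: "marked w (h - 1) = 3 \<longleftrightarrow> h = 0"
  by (auto simp: marked_def)

lemma marked_eq_4: "marked w (h - 1) = 4 \<longleftrightarrow> h = int (Suc (length w))"
  by (auto simp: marked_def)

lemma marked_eq_2: "marked w (int v - 1) = 2 \<longleftrightarrow> 1 \<le> v \<and> v \<le> length w \<and> w ! (v - 1)"
  by (auto simp: marked_def nat_diff_distrib)

section \<open>Programs that only move heads\<close>

definition Seq :: "prog \<Rightarrow> prog \<Rightarrow> prog" where
  "Seq p q = Branch p q q"

text \<open>\<open>f\<close> sees the symbols as a function of the tape number. Each tape gets back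
  the symbol that was read, so tape contents never change.\<close>

definition Move :: "((nat \<Rightarrow> nat) \<Rightarrow> bool option \<times> (nat \<Rightarrow> dir)) \<Rightarrow> prog" where
  "Move f = Prim (\<lambda>ss. (fst (f ((!) ss)),
     map (\<lambda>i. (ss ! i, snd (f ((!) ss)) i)) [0..<length ss]))"

definition Ret :: "bool \<Rightarrow> prog" where
  "Ret b = Move (\<lambda>_. (Some b, \<lambda>_. Stay))"

definition Test :: "nat \<Rightarrow> nat \<Rightarrow> prog" where
  "Test v a = Move (\<lambda>\<sigma>. (Some (\<sigma> v = a), \<lambda>_. Stay))"

definition drain_step :: "nat \<Rightarrow> (nat \<Rightarrow> dir) \<Rightarrow> prog" where
  "drain_step v d = Move (\<lambda>\<sigma>. if \<sigma> v = 3 then (Some True, \<lambda>_. Stay) else (None, d))"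

text \<open>With \<open>d v = Move_Left\<close> the number of rounds is the value of
  \<open>v\<close>, so every other head can be shifted by just this value: addition in
  unary.\<close>

definition drain :: "nat \<Rightarrow> (nat \<Rightarrow> dir) \<Rightarrow> prog" where
  "drain v d = Loop (drain_step v d) (drain_step v d)"

lemma runs_Seq:
  "runs p Ts t (Some b) Ts' \<Longrightarrow> runs q Ts' t' v Ts'' \<Longrightarrow> runs (Seq p q) Ts (t + t') v Ts''"
  unfolding Seq_def by (rule runs_Branch[where b = b]) simp_all

lemma runs_Move:
  assumes "f ((!) (map (\<lambda>i. marked w (h i - 1)) [0..<K])) = (v, d)"
  shows "runs (Move f) (tapes K w h) (Suc t) v (tapes K w (\<lambda>i. h i + dir_offset (d i)))"
proof -
  let ?ss = "map (\<lambda>i. marked w (h i - 1)) [0..<K]"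
  have ss: "map read_tape (tapes K w h) = ?ss" by (simp add: tapes_def read_tape_def)
  have acts: "map2 act (map (\<lambda>i. (?ss ! i, d i)) [0..<K]) (tapes K w h)
      = tapes K w (\<lambda>i. h i + dir_offset (d i))"
    by (rule nth_equalityI) (auto simp: tapes_def)
  have "pstep (Move f) (map read_tape (tapes K w h)) = (Inr v, map (\<lambda>i. (?ss ! i, d i)) [0..<K])"
    unfolding ss by (simp add: Move_def assms)
  from runs.halt[OF this, unfolded acts] show ?thesis .
qed

lemma runs_Ret: "runs (Ret b) (tapes K w h) (Suc t) (Some b) (tapes K w h)"
  unfolding Ret_def by (rule runs_Move[THEN back_subst[of "runs _ _ _ _"]]) (rule refl, simp)

lemma runs_Test:
  "v < K \<Longrightarrow> b = (marked w (h v - 1) = a) \<Longrightarrow>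
   runs (Test v a) (tapes K w h) (Suc t) (Some b) (tapes K w h)"
  unfolding Test_def by (rule runs_Move[THEN back_subst[of "runs _ _ _ _"]]) (simp, simp)

lemma runs_drain:
  assumes "v < K" "d v = Move_Left"
  shows "h v = int n \<Longrightarrow> runs (drain v d) (tapes K w h) (Suc n) (Some True)
     (tapes K w (\<lambda>i. h i + int n * dir_offset (d i)))"
proof (induction n arbitrary: h)
  case 0
  have "runs (drain_step v d) (tapes K w h) 1 (Some True)
      (tapes K w (\<lambda>i. h i + dir_offset ((\<lambda>_. Stay) i)))"
    unfolding drain_step_def One_nat_def
    by (rule runs_Move) (use 0 assms marked_eq_3[of w "h v"] in auto)
  from runs_Loop_exit[OF this] show ?case by (simp add: drain_def)
next
  case (Suc n)
  have *: "runs (drain_step v d) (tapes K w h) 1 None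
      (tapes K w (\<lambda>i. h i + dir_offset (d i)))"
    unfolding drain_step_def One_nat_def
    by (rule runs_Move) (use Suc.prems assms marked_eq_3[of w "h v"] in auto)
  have "h v + dir_offset (d v) = int n" using Suc.prems assms by simp
  from Suc.IH[of "\<lambda>i. h i + dir_offset (d i)", OF this] have "runs (drain v d) (tapes K w (\<lambda>i. h i + dir_offset (d i))) (Suc n)
      (Some True) (tapes K w (\<lambda>i. h i + int (Suc n) * dir_offset (d i)))"
    by (simp add: algebra_simps)
  from runs_Loop_again[OF * this[unfolded drain_def]] show ?case by (simp add: drain_def)
qed

lemma wf_Move: "wf_prog K (Move f)"
  unfolding Move_def by (auto simp: image_iff subset_iff)

lemma wf_Seq: "wf_prog K (Seq p q) \<longleftrightarrow> wf_prog K p \<and> wf_prog K q"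
  by (auto simp: Seq_def)

lemma wf_drain: "wf_prog K (drain v d)"
  by (simp add: drain_def drain_step_def wf_Move)


subsection \<open>Evaluation of formulas\<close>

text \<open>
  Variables range over the positions from \<open>0\<close> to \<open>length w + 1\<close>, where \<open>0\<close> and \<open>length w + 1\<close> are
  those of the end markers.
\<close>

datatype fm = FBit nat | FLin "nat list" "nat list" nat | FNot fm | FAnd fm fm | FEx nat fm

text \<open>Coefficients in \<open>FLin\<close> are expressed by repeating a variable. Position 0 is
  the left marker, so position \<open>a\<close> carries the letter with index
  \<open>a - 1\<close>.\<close>

primrec sat :: "bool list \<Rightarrow> (nat \<Rightarrow> nat) \<Rightarrow> fm \<Rightarrow> bool" where
  "sat w e (FBit v) \<longleftrightarrow> 1 \<le> e v \<and> e v \<le> length w \<and> w ! (e v - 1)"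
| "sat w e (FLin ps ns c) \<longleftrightarrow> sum_list (map e ps) + c = sum_list (map e ns)"
| "sat w e (FNot \<phi>) \<longleftrightarrow> \<not> sat w e \<phi>"
| "sat w e (FAnd \<phi> \<psi>) \<longleftrightarrow> sat w e \<phi> \<and> sat w e \<psi>"
| "sat w e (FEx v \<phi>) \<longleftrightarrow> (\<exists>a \<le> Suc (length w). sat w (e(v := a)) \<phi>)"

primrec fvars :: "fm \<Rightarrow> nat set" where
  "fvars (FBit v) = {v}"
| "fvars (FLin ps ns c) = set ps \<union> set ns"
| "fvars (FNot \<phi>) = fvars \<phi>"
| "fvars (FAnd \<phi> \<psi>) = fvars \<phi> \<union> fvars \<psi>"
| "fvars (FEx v \<phi>) = insert v (fvars \<phi>)"

primrec bvars :: "fm \<Rightarrow> nat set" where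
  "bvars (FBit v) = {}"
| "bvars (FLin ps ns c) = {}"
| "bvars (FNot \<phi>) = bvars \<phi>"
| "bvars (FAnd \<phi> \<psi>) = bvars \<phi> \<union> bvars \<psi>"
| "bvars (FEx v \<phi>) = insert v (bvars \<phi>)"

text \<open>No quantifier occurs in the scope of another one for the same variable. Thus the tape of
  a bound variable is free, with its head on the left marker, whenever its loop begins.\<close>

primrec wf_fm :: "fm \<Rightarrow> bool" where
  "wf_fm (FBit v) = True"
| "wf_fm (FLin ps ns c) = True"
| "wf_fm (FNot \<phi>) = wf_fm \<phi>"
| "wf_fm (FAnd \<phi> \<psi>) = (wf_fm \<phi> \<and> wf_fm \<psi>)"
| "wf_fm (FEx v \<phi>) = (wf_fm \<phi> \<and> v \<notin> bvars \<phi>)"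

text \<open>
  For variables below \<open>D\<close>, tape \<open>D\<close> serves to restore the head of a variable that has been moved to
  the left marker, and tape \<open>D + 1\<close> accumulates the value of a linear term.
\<close>

definition heads :: "nat \<Rightarrow> (nat \<Rightarrow> nat) \<Rightarrow> int \<Rightarrow> nat \<Rightarrow> int" where
  "heads D e x i = (if i < D then int (e i) else if i = D then 0 else x)"

definition add_var :: "nat \<Rightarrow> dir \<Rightarrow> nat \<Rightarrow> prog" where
  "add_var D dir v = Seq
     (drain v ((\<lambda>_. Stay)(v := Move_Left, D := Move_Right, Suc D := dir)))
     (drain D ((\<lambda>_. Stay)(D := Move_Left, v := Move_Right)))"

definition add_one :: "nat \<Rightarrow> dir \<Rightarrow> prog" where
  "add_one D dir = Move (\<lambda>_. (Some True, (\<lambda>_. Stay)(Suc D := dir)))"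

text \<open>Exchanging the two directions gives a program that undoes the effect on the
  accumulator.\<close>

definition add_lin :: "nat \<Rightarrow> dir \<Rightarrow> dir \<Rightarrow> nat list \<Rightarrow> nat list \<Rightarrow> nat \<Rightarrow> prog" where
  "add_lin D dir dir' ps ns c = foldr Seq
     (map (add_var D dir) ps @ replicate c (add_one D dir) @ map (add_var D dir') ns) (Ret True)"

text \<open>Every evaluation returns all heads to where it found them, which allows subformulas to
  be evaluated one after the other and repeatedly. For \<open>FEx\<close>, the result
  \<open>None\<close> restarts the body after \<open>v\<close> has advanced by one cell.\<close>

primrec eval_prog :: "nat \<Rightarrow> fm \<Rightarrow> prog" where
  "eval_prog D (FBit v) = Test v 2"
| "eval_prog D (FLin ps ns c) =
     (let undo = add_lin D Move_Left Move_Right ps ns c in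
      Seq (add_lin D Move_Right Move_Left ps ns c)
        (Branch (Test (Suc D) 3) (Seq undo (Ret True)) (Seq undo (Ret False))))"
| "eval_prog D (FNot \<phi>) = Branch (eval_prog D \<phi>) (Ret False) (Ret True)"
| "eval_prog D (FAnd \<phi> \<psi>) = Branch (eval_prog D \<phi>) (eval_prog D \<psi>) (Ret False)"
| "eval_prog D (FEx v \<phi>) =
     (let rewind = drain v ((\<lambda>_. Stay)(v := Move_Left));
          body = Branch (eval_prog D \<phi>) (Seq rewind (Ret True))
            (Branch (Test v 4) (Seq rewind (Ret False))
              (Move (\<lambda>_. (None, (\<lambda>_. Stay)(v := Move_Right)))))
      in Loop body body)"

text \<open>For \<open>FLin\<close>: two passes over \<open>m\<close> summands, each summand within
  \<open>2 * length w + 4\<close> steps, and a few single steps. For \<open>FEx\<close>: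
  \<open>length w + 2\<close> rounds, each with two steps besides the evaluation, and one final
  rewinding.\<close>

primrec eval_time :: "fm \<Rightarrow> nat poly" where
  "eval_time (FBit v) = [:1:]"
| "eval_time (FLin ps ns c) = (let m = length ps + c + length ns in [:8 * m + 4, 4 * m:])"
| "eval_time (FNot \<phi>) = eval_time \<phi> + [:1:]"
| "eval_time (FAnd \<phi> \<psi>) = eval_time \<phi> + eval_time \<psi> + [:1:]"
| "eval_time (FEx v \<phi>) = [:2, 1:] * (eval_time \<phi> + [:2:]) + [:3, 1:]"

text \<open>The time bound is that of two drains, each of at most \<open>length w + 2\<close>
  steps.\<close>

definition adds :: "nat \<Rightarrow> bool list \<Rightarrow> (nat \<Rightarrow> nat) \<Rightarrow> prog \<Rightarrow> int \<Rightarrow> bool" where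
  "adds D w e p a \<longleftrightarrow> (\<forall>x. runs p (tapes (D + 2) w (heads D e x)) (2 * length w + 4) (Some True)
     (tapes (D + 2) w (heads D e (x + a))))"

lemma adds_add_var:
  assumes "v < D" "e v \<le> Suc (length w)"
  shows "adds D w e (add_var D dir v) (dir_offset dir * int (e v))"
  unfolding adds_def
proof
  fix x
  let ?d = "(\<lambda>_. Stay)(v := Move_Left, D := Move_Right, Suc D := dir)"
  let ?d' = "(\<lambda>_. Stay)(D := Move_Left, v := Move_Right)"
  let ?h = "\<lambda>i. heads D e x i + int (e v) * dir_offset (?d i)"
  have 1: "runs (drain v ?d) (tapes (D + 2) w (heads D e x)) (Suc (e v)) (Some True) (tapes (D + 2) w ?h)"
    by (rule runs_drain) (use assms in \<open>auto simp: heads_def\<close>)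
  have 2: "runs (drain D ?d') (tapes (D + 2) w ?h) (Suc (e v)) (Some True)
      (tapes (D + 2) w (\<lambda>i. ?h i + int (e v) * dir_offset (?d' i)))"
    by (rule runs_drain) (use assms in \<open>auto simp: heads_def\<close>)
  have 3: "tapes (D + 2) w (\<lambda>i. ?h i + int (e v) * dir_offset (?d' i))
      = tapes (D + 2) w (heads D e (x + dir_offset dir * int (e v)))"
    by (rule tapes_cong) (use assms in \<open>auto simp: heads_def\<close>)
  show "runs (add_var D dir v) (tapes (D + 2) w (heads D e x)) (2 * length w + 4) (Some True)
      (tapes (D + 2) w (heads D e (x + dir_offset dir * int (e v))))"
    unfolding add_var_def 3[symmetric]
    by (rule runs_mono[OF runs_Seq[OF 1 2]]) (use assms(2) in simp)
qed

lemma adds_add_one: "adds D w e (add_one D dir) (dir_offset dir)"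
  unfolding adds_def
proof
  fix x
  let ?d = "(\<lambda>_. Stay)(Suc D := dir)"
  have 1: "runs (add_one D dir) (tapes (D + 2) w (heads D e x)) (Suc (2 * length w + 3)) (Some True)
      (tapes (D + 2) w (\<lambda>i. heads D e x i + dir_offset (?d i)))"
    unfolding add_one_def by (rule runs_Move[where d = ?d]) simp
  have 2: "tapes (D + 2) w (\<lambda>i. heads D e x i + dir_offset (?d i))
      = tapes (D + 2) w (heads D e (x + dir_offset dir))"
    by (rule tapes_cong) (auto simp: heads_def)
  show "runs (add_one D dir) (tapes (D + 2) w (heads D e x)) (2 * length w + 4) (Some True)
      (tapes (D + 2) w (heads D e (x + dir_offset dir)))"
    using runs_mono[OF 1[unfolded 2]] by simp
qed

lemma runs_foldr_Seq:
  assumes "list_all2 (adds D w e) ps as"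
  shows "runs (foldr Seq ps (Ret True)) (tapes (D + 2) w (heads D e x))
     (length ps * (2 * length w + 4) + 1) (Some True) (tapes (D + 2) w (heads D e (x + sum_list as)))"
  using assms
proof (induction arbitrary: x rule: list_all2_induct)
  case Nil
  show ?case using runs_Ret[of True _ _ _ 0] by simp
next
  case (Cons p ps a as)
  from runs_Seq[OF Cons.hyps(1)[unfolded adds_def, rule_format] Cons.IH]
  show ?case by (simp add: add.assoc)
qed

lemma runs_add_lin:
  assumes "\<And>v. v \<in> set ps \<union> set ns \<Longrightarrow> v < D \<and> e v \<le> Suc (length w)"
  shows "runs (add_lin D dir dir' ps ns c) (tapes (D + 2) w (heads D e x))
     ((length ps + c + length ns) * (2 * length w + 4) + 1) (Some True)
     (tapes (D + 2) w (heads D e (x + (dir_offset dir * (int (sum_list (map e ps)) + int c)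
        + dir_offset dir' * int (sum_list (map e ns))))))"
proof -
  have vs: "list_all2 (adds D w e) (map (add_var D d) vs) (map (\<lambda>v. dir_offset d * int (e v)) vs)"
    if "set vs \<subseteq> set ps \<union> set ns" for d vs
    using that assms by (auto simp: list_all2_conv_all_nth subset_iff intro!: adds_add_var)
  have "list_all2 (adds D w e)
      (map (add_var D dir) ps @ replicate c (add_one D dir) @ map (add_var D dir') ns)
      (map (\<lambda>v. dir_offset dir * int (e v)) ps @ replicate c (dir_offset dir) @
        map (\<lambda>v. dir_offset dir' * int (e v)) ns)"
    by (intro list_all2_appendI vs) (auto simp: list_all2_conv_all_nth intro: adds_add_one)
  from runs_foldr_Seq[OF this, of x] show ?thesis
    by (simp add: add_lin_def sum_list_const_mult sum_list_replicate algebra_simps o_def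
        flip: sum_list_of_nat)
qed

text \<open>The last hypothesis says that the heads of bound variables start on the left marker. It
  survives the change of \<open>e v\<close> in a loop because \<open>wf_fm\<close> excludes
  \<open>v\<close> from the bound variables of the body.\<close>

lemma runs_eval_prog:
  assumes "wf_fm \<phi>" "fvars \<phi> \<subseteq> {..<D}" "\<And>v. v < D \<Longrightarrow> e v \<le> Suc (length w)"
    "\<And>v. v \<in> bvars \<phi> \<Longrightarrow> e v = 0"
  shows "runs (eval_prog D \<phi>) (tapes (D + 2) w (heads D e 0)) (poly (eval_time \<phi>) (length w))
    (Some (sat w e \<phi>)) (tapes (D + 2) w (heads D e 0))"
  using assms
proof (induction \<phi> arbitrary: e)
  case (FBit v)
  then have v: "v < D" by simp
  then have "heads D e 0 v = int (e v)" by (simp add: heads_def)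
  with v show ?case using runs_Test[of v "D + 2" _ w "heads D e 0" 2 0]
    by (simp add: marked_eq_2)
next
  case (FLin ps ns c)
  let ?x = "int (sum_list (map e ps)) + int c - int (sum_list (map e ns))"
  let ?m = "(length ps + c + length ns) * (2 * length w + 4) + 1"
  have v: "v < D \<and> e v \<le> Suc (length w)" if "v \<in> set ps \<union> set ns" for v
    using FLin that by auto
  have 1: "runs (add_lin D Move_Right Move_Left ps ns c) (tapes (D + 2) w (heads D e 0)) ?m (Some True)
      (tapes (D + 2) w (heads D e ?x))"
    using runs_add_lin[of ps ns, OF v, where c = c and x = 0 and dir = Move_Right and dir' = Move_Left] by simp
  have 2: "runs (add_lin D Move_Left Move_Right ps ns c) (tapes (D + 2) w (heads D e ?x)) ?m (Some True)
      (tapes (D + 2) w (heads D e 0))"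
    using runs_add_lin[of ps ns, OF v, where c = c and x = ?x and dir = Move_Left and dir' = Move_Right] by simp
  have 3: "runs (Seq (add_lin D Move_Left Move_Right ps ns c) (Ret b))
      (tapes (D + 2) w (heads D e ?x)) (?m + 1) (Some b) (tapes (D + 2) w (heads D e 0))" for b
    using runs_Seq[OF 2 runs_Ret[of b _ _ _ 0]] by simp
  \<comment> \<open>The accumulator may have left the marked word on either side; the test is still
    exact, because the symbol 3 stands in a single cell.\<close>
  have 4: "runs (Test (Suc D) 3) (tapes (D + 2) w (heads D e ?x)) (Suc 0) (Some (?x = 0))
      (tapes (D + 2) w (heads D e ?x))"
    by (rule runs_Test) (auto simp: heads_def marked_eq_3)
  have 5: "runs (if ?x = 0 then Seq (add_lin D Move_Left Move_Right ps ns c) (Ret True)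
       else Seq (add_lin D Move_Left Move_Right ps ns c) (Ret False))
      (tapes (D + 2) w (heads D e ?x)) (?m + 1) (Some (?x = 0)) (tapes (D + 2) w (heads D e 0))"
    using 3 by presburger
  have 6: "runs (eval_prog D (FLin ps ns c)) (tapes (D + 2) w (heads D e 0)) (?m + (Suc 0 + (?m + 1)))
      (Some (?x = 0)) (tapes (D + 2) w (heads D e 0))"
    unfolding eval_prog.simps Let_def by (rule runs_Seq[OF 1 runs_Branch[OF 4 5]])
  have 7: "?x = 0 \<longleftrightarrow> sat w e (FLin ps ns c)"
    unfolding sat.simps by linarith
  show ?case
    using 6 unfolding 7 by (rule runs_mono) (simp add: Let_def algebra_simps)
next
  case (FNot \<phi>)
  have 1: "runs (eval_prog D \<phi>) (tapes (D + 2) w (heads D e 0)) (poly (eval_time \<phi>) (length w))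
    (Some (sat w e \<phi>)) (tapes (D + 2) w (heads D e 0))"
    by (rule FNot.IH) (use FNot.prems in auto)
  have 2: "runs (if sat w e \<phi> then Ret False else Ret True) (tapes (D + 2) w (heads D e 0)) (Suc 0)
    (Some (\<not> sat w e \<phi>)) (tapes (D + 2) w (heads D e 0))"
    using runs_Ret by simp
  from runs_Branch[OF 1 2] show ?case by simp
next
  case (FAnd \<phi> \<psi>)
  have 1: "runs (eval_prog D \<phi>) (tapes (D + 2) w (heads D e 0)) (poly (eval_time \<phi>) (length w))
    (Some (sat w e \<phi>)) (tapes (D + 2) w (heads D e 0))"
    by (rule FAnd.IH) (use FAnd.prems in auto)
  have 2: "runs (eval_prog D \<psi>) (tapes (D + 2) w (heads D e 0)) (poly (eval_time \<psi>) (length w))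
    (Some (sat w e \<psi>)) (tapes (D + 2) w (heads D e 0))"
    by (rule FAnd.IH) (use FAnd.prems in auto)
  have 3: "runs (if sat w e \<phi> then eval_prog D \<psi> else Ret False) (tapes (D + 2) w (heads D e 0))
      (poly (eval_time \<psi>) (length w) + 1)
    (Some (sat w e \<phi> \<and> sat w e \<psi>)) (tapes (D + 2) w (heads D e 0))"
    using runs_mono[OF 2] runs_Ret by simp
  from runs_Branch[OF 1 3] show ?case by (simp add: add.assoc)
next
  case (FEx v \<phi>)
  let ?N = "Suc (length w)" and ?T = "poly (eval_time \<phi>) (length w)"
  let ?tp = "\<lambda>e. tapes (D + 2) w (heads D e 0)"
  let ?rewind = "drain v ((\<lambda>_. Stay)(v := Move_Left))"
  let ?inc = "Move (\<lambda>_. (None, (\<lambda>_. Stay)(v := Move_Right)))"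
  let ?next = "Branch (Test v 4) (Seq ?rewind (Ret False)) ?inc"
  let ?body = "Branch (eval_prog D \<phi>) (Seq ?rewind (Ret True)) ?next"
  have v: "v < D" "e v = 0" using FEx.prems by auto
  have phi: "runs (eval_prog D \<phi>) (?tp (e(v := a))) ?T (Some (sat w (e(v := a)) \<phi>)) (?tp (e(v := a)))"
    if "a \<le> ?N" for a
    by (rule FEx.IH) (use FEx.prems that in auto)
  have rewind: "runs (Seq ?rewind (Ret b)) (?tp (e(v := a))) (?N + 2) (Some b) (?tp e)" if "a \<le> ?N" for a b
  proof -
    have 1: "runs ?rewind (?tp (e(v := a))) (Suc a) (Some True)
       (tapes (D + 2) w (\<lambda>i. heads D (e(v := a)) 0 i + int a * dir_offset (((\<lambda>_. Stay)(v := Move_Left)) i)))"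
      by (rule runs_drain) (use v in \<open>auto simp: heads_def\<close>)
    have 2: "tapes (D + 2) w (\<lambda>i. heads D (e(v := a)) 0 i + int a * dir_offset (((\<lambda>_. Stay)(v := Move_Left)) i))
        = ?tp e"
      by (rule tapes_cong) (use v in \<open>auto simp: heads_def\<close>)
    show ?thesis
      by (rule runs_mono[OF runs_Seq[OF 1[unfolded 2] runs_Ret[of _ _ _ _ 0]]]) (use that in simp)
  qed
  have test: "runs (Test v 4) (?tp (e(v := a))) (Suc 0) (Some (a = ?N)) (?tp (e(v := a)))" for a
    by (rule runs_Test) (use v marked_eq_4[of w "int a"] in \<open>auto simp: heads_def\<close>)
  have inc: "runs ?inc (?tp (e(v := a))) (Suc 0) None (?tp (e(v := Suc a)))" for a
  proof -
    have "runs ?inc (?tp (e(v := a))) (Suc 0) None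
        (tapes (D + 2) w (\<lambda>i. heads D (e(v := a)) 0 i + dir_offset (((\<lambda>_. Stay)(v := Move_Right)) i)))"
      by (rule runs_Move[where d = "(\<lambda>_. Stay)(v := Move_Right)"]) simp
    moreover have "tapes (D + 2) w (\<lambda>i. heads D (e(v := a)) 0 i + dir_offset (((\<lambda>_. Stay)(v := Move_Right)) i))
        = ?tp (e(v := Suc a))"
      by (rule tapes_cong) (use v in \<open>auto simp: heads_def\<close>)
    ultimately show ?thesis by simp
  qed
  \<comment> \<open>\<open>k\<close> counts the positions after \<open>a\<close> that are still to
    be tried; the rewinding is paid only once, at the end.\<close>
  have loop: "runs (Loop ?body ?body) (?tp (e(v := a))) (Suc k * (?T + 2) + (?N + 2))
      (Some (\<exists>a'\<in>{a..?N}. sat w (e(v := a')) \<phi>)) (?tp e)" if "a + k = ?N" for a k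
    using that
  proof (induction k arbitrary: a)
    case 0
    then have a: "a = ?N" by simp
    show ?case
    proof (cases "sat w (e(v := a)) \<phi>")
      case True
      have "runs ?body (?tp (e(v := a))) (?T + (?N + 2)) (Some True) (?tp e)"
        by (rule runs_Branch[OF phi]) (use True rewind a in simp_all)
      moreover have "(\<exists>a'\<in>{a..?N}. sat w (e(v := a')) \<phi>) = True" using True a by auto
      ultimately show ?thesis by (simp only:) (erule runs_mono[OF runs_Loop_exit], simp)
    next
      case False
      have "runs ?next (?tp (e(v := a))) (Suc 0 + (?N + 2)) (Some False) (?tp e)"
        by (rule runs_Branch[OF test]) (use rewind a in simp)
      then have "runs ?body (?tp (e(v := a))) (?T + (Suc 0 + (?N + 2))) (Some False) (?tp e)"
        by (intro runs_Branch[OF phi]) (use False a in simp_all)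
      moreover have "(\<exists>a'\<in>{a..?N}. sat w (e(v := a')) \<phi>) = False" using False a by auto
      ultimately show ?thesis by (simp only:) (erule runs_mono[OF runs_Loop_exit], simp)
    qed
  next
    case (Suc k)
    show ?case
    proof (cases "sat w (e(v := a)) \<phi>")
      case True
      have "runs ?body (?tp (e(v := a))) (?T + (?N + 2)) (Some True) (?tp e)"
        by (rule runs_Branch[OF phi]) (use True rewind Suc.prems in simp_all)
      moreover have "(\<exists>a'\<in>{a..?N}. sat w (e(v := a')) \<phi>) = True" using True Suc.prems by auto
      ultimately show ?thesis by (simp only:) (erule runs_mono[OF runs_Loop_exit], simp)
    next
      case False
      have "runs ?next (?tp (e(v := a))) (Suc 0 + Suc 0) None (?tp (e(v := Suc a)))"
        by (rule runs_Branch[OF test]) (use inc Suc.prems in auto)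
      then have 1: "runs ?body (?tp (e(v := a))) (?T + (Suc 0 + Suc 0)) None (?tp (e(v := Suc a)))"
        by (intro runs_Branch[OF phi]) (use False Suc.prems in simp_all)
      have "a' = a \<or> Suc a \<le> a'" if "a \<le> a'" for a' using that by auto
      then have 2: "(\<exists>a'\<in>{Suc a..?N}. sat w (e(v := a')) \<phi>) = (\<exists>a'\<in>{a..?N}. sat w (e(v := a')) \<phi>)"
        using False by (metis Suc_leD atLeastAtMost_iff)
      have "Suc a + k = ?N" using Suc.prems by simp
      from runs_Loop_again[OF 1 Suc.IH[OF this, unfolded 2]] show ?thesis
        by (rule runs_mono) simp
    qed
  qed
  have "e(v := 0) = e" using v by auto
  then have "runs (eval_prog D (FEx v \<phi>)) (?tp e) (Suc ?N * (?T + 2) + (?N + 2))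
      (Some (\<exists>a'\<in>{0..?N}. sat w (e(v := a')) \<phi>)) (?tp e)"
    using loop[of 0 ?N] by (simp add: Let_def)
  moreover have "(\<exists>a'\<in>{0..?N}. sat w (e(v := a')) \<phi>) \<longleftrightarrow> sat w e (FEx v \<phi>)" by auto
  ultimately have "runs (eval_prog D (FEx v \<phi>)) (?tp e) (Suc ?N * (?T + 2) + (?N + 2))
      (Some (sat w e (FEx v \<phi>))) (?tp e)" by simp
  then show ?case by (rule runs_mono) simp
qed

lemma wf_eval_prog: "wf_prog K (eval_prog D \<phi>)"
proof -
  have seq: "wf_prog K (foldr Seq ps (Ret True))" if "\<forall>p\<in>set ps. wf_prog K p" for ps
    using that by (induction ps) (auto simp: wf_Seq Ret_def wf_Move)
  have "wf_prog K (add_lin D d d' ps ns c)" for d d' ps ns c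
    unfolding add_lin_def
    by (rule seq) (auto simp: add_var_def add_one_def wf_Seq wf_drain wf_Move)
  then show ?thesis
    by (induction \<phi>) (simp_all add: Let_def wf_Seq wf_drain wf_Move Test_def Ret_def)
qed


subsection \<open>Preparation of the tapes\<close>

text \<open>The first tape decides for all tapes. Its first blank is the end of the input, as input
  letters are 1 and 2; there the right marker is written on every tape. The way back then ends at
  the blank in cell -1, which becomes the left marker.\<close>

definition copy_step :: prog where
  "copy_step = Prim (\<lambda>ss. if hd ss \<noteq> 0 then (None, map (\<lambda>_. (hd ss, Move_Right)) ss)
     else (Some True, map (\<lambda>_. (4, Move_Left)) ss))"

definition return_step :: prog where
  "return_step = Prim (\<lambda>ss. if hd ss \<noteq> 0 then (None, map (\<lambda>s. (s, Move_Left)) ss)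
     else (Some True, map (\<lambda>_. (3, Stay)) ss))"

lemma map2_act_map: "map2 act (map f (map g Ts)) Ts = map (\<lambda>T. act (f (g T)) T) Ts"
  by (induction Ts) auto

lemma runs_copy:
  fixes x :: "bool list"
  defines "inp \<equiv> snd (input_tape x)"
  assumes "j + k = length x"
  shows "runs (Loop copy_step copy_step)
     ((int j, inp) # replicate m (int j, \<lambda>i. if i < int j then inp i else 0)) (Suc k) (Some True)
     (replicate (Suc m) (int (length x) - 1, inp(int (length x) := 4)))"
  using assms(2)
proof (induction k arbitrary: j)
  case 0
  then have j: "j = length x" by simp
  have inp: "inp (int (length x)) = 0" by (simp add: inp_def input_tape_def)
  have 1: "(\<lambda>i. if i < int (length x) then inp i else 0) = inp"
    by (auto simp: inp_def input_tape_def)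
  have "runs copy_step ((int j, inp) # replicate m (int j, inp)) (Suc 0) (Some True)
     (map2 act (map (\<lambda>_. (4, Move_Left)) (map read_tape ((int j, inp) # replicate m (int j, inp))))
       ((int j, inp) # replicate m (int j, inp)))"
    by (rule runs.halt) (simp add: copy_step_def read_tape_def j inp)
  from runs_Loop_exit[OF this] show ?case
    unfolding map2_act_map j 1 by (simp add: fun_upd_def)
next
  case (Suc k)
  let ?Ts = "(int j, inp) # replicate m (int j, \<lambda>i. if i < int j then inp i else 0)"
  have inp: "inp (int j) \<noteq> 0" using Suc.prems by (simp add: inp_def input_tape_def)
  have "runs copy_step ?Ts 1 None
     (map2 act (map (\<lambda>_. (inp (int j), Move_Right)) (map read_tape ?Ts)) ?Ts)"
    unfolding One_nat_def by (rule runs.halt) (simp add: copy_step_def read_tape_def inp)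
  also have "map2 act (map (\<lambda>_. (inp (int j), Move_Right)) (map read_tape ?Ts)) ?Ts =
      (int (Suc j), inp) # replicate m (int (Suc j), \<lambda>i. if i < int (Suc j) then inp i else 0)"
    unfolding map2_act_map by (auto simp: fun_eq_iff)
  finally have 1: "runs copy_step ?Ts 1 None ((int (Suc j), inp) #
      replicate m (int (Suc j), \<lambda>i. if i < int (Suc j) then inp i else 0))" .
  have "Suc j + k = length x" using Suc.prems by simp
  from runs_Loop_again[OF 1 Suc.IH[OF this]] show ?case by simp
qed

lemma runs_return:
  assumes "k \<le> length x"
  shows "runs (Loop return_step return_step)
     (replicate (Suc m) (int k - 1, (snd (input_tape x))(int (length x) := 4))) (Suc k) (Some True)
     (tapes (Suc m) x (\<lambda>_. 0))"
  using assms
proof (induction k)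
  case 0
  let ?f = "(snd (input_tape x))(int (length x) := 4)"
  let ?Ts = "replicate (Suc m) (- 1 :: int, ?f)"
  have "runs return_step ?Ts (Suc 0) (Some True) (map2 act (map (\<lambda>_. (3, Stay)) (map read_tape ?Ts)) ?Ts)"
    by (rule runs.halt) (simp add: return_step_def read_tape_def input_tape_def)
  moreover have "?f(- 1 := 3) = marked x"
    by (auto simp: fun_eq_iff marked_def input_tape_def)
  then have "map2 act (map (\<lambda>_. (3, Stay)) (map read_tape ?Ts)) ?Ts = tapes (Suc m) x (\<lambda>_. 0)"
    unfolding map2_act_map tapes_def by (simp add: map_replicate_const del: upt_Suc)
  ultimately have "runs return_step ?Ts (Suc 0) (Some True) (tapes (Suc m) x (\<lambda>_. 0))"
    by (simp only:)
  from runs_Loop_exit[OF this, of return_step] show ?case by (simp add: fun_upd_def)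
next
  case (Suc k)
  let ?f = "(snd (input_tape x))(int (length x) := 4)"
  let ?Ts = "replicate (Suc m) (int k, ?f)"
  have "runs return_step ?Ts 1 None (map2 act (map (\<lambda>s. (s, Move_Left)) (map read_tape ?Ts)) ?Ts)"
    unfolding One_nat_def
    by (rule runs.halt) (use Suc.prems in \<open>simp add: return_step_def read_tape_def input_tape_def\<close>)
  moreover have "map2 act (map (\<lambda>s. (s, Move_Left)) (map read_tape ?Ts)) ?Ts = replicate (Suc m) (int k - 1, ?f)"
    unfolding map2_act_map by (simp add: read_tape_def fun_eq_iff)
  ultimately have 1: "runs return_step ?Ts 1 None (replicate (Suc m) (int k - 1, ?f))" by simp
  have "k \<le> length x" using Suc.prems by simp
  from runs_Loop_again[OF 1 Suc.IH[OF this]] show ?case by (simp add: fun_upd_def)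
qed

theorem PTIME_first_order:
  assumes "wf_fm \<phi>"
  shows "{w. sat w (\<lambda>_. 0) \<phi>} \<in> PTIME"
proof -
  have "finite (fvars \<phi>)" by (induction \<phi>) auto
  then obtain D where D: "fvars \<phi> \<subseteq> {..<D}" by (auto simp: finite_nat_iff_bounded)
  let ?p = "Seq (Loop copy_step copy_step) (Seq (Loop return_step return_step) (eval_prog D \<phi>))"
  have hd: "hd ss < 5" if "set ss \<subseteq> {..<5}" "ss \<noteq> []" for ss :: "nat list"
    using that by (cases ss) auto
  show ?thesis
  proof (rule PTIME_prog[where p = ?p and K = "D + 2" and T = "[:2, 2:] + eval_time \<phi>"])
    show "wf_prog (D + 2) ?p"
      by (auto simp: wf_Seq wf_eval_prog copy_step_def return_step_def intro!: hd)
    fix x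
    have 1: "runs (Loop copy_step copy_step) (input_tape x # replicate (D + 2 - 1) blank_tape)
        (Suc (length x)) (Some True)
       (replicate (Suc (Suc D)) (int (length x) - 1, (snd (input_tape x))(int (length x) := 4)))"
    proof -
      have "(\<lambda>i. if i < 0 then snd (input_tape x) i else 0) = (\<lambda>i. 0)"
        by (auto simp: input_tape_def)
      then show ?thesis using runs_copy[of 0 "length x" x "Suc D"]
        by (simp add: blank_tape_def input_tape_def)
    qed
    have 2: "runs (eval_prog D \<phi>) (tapes (D + 2) x (heads D (\<lambda>_. 0) 0)) (poly (eval_time \<phi>) (length x))
      (Some (sat x (\<lambda>_. 0) \<phi>)) (tapes (D + 2) x (heads D (\<lambda>_. 0) 0))"
      by (rule runs_eval_prog) (use assms D in auto)
    have 3: "tapes (D + 2) x (heads D (\<lambda>_. 0) 0) = tapes (Suc (Suc D)) x (\<lambda>_. 0)"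
      by (simp add: heads_def tapes_def)
    have "runs ?p (input_tape x # replicate (D + 2 - 1) blank_tape)
        (Suc (length x) + (Suc (length x) + poly (eval_time \<phi>) (length x)))
        (Some (sat x (\<lambda>_. 0) \<phi>)) (tapes (Suc (Suc D)) x (\<lambda>_. 0))"
      by (rule runs_Seq[OF 1 runs_Seq[OF runs_return 2[unfolded 3]]]) simp
    from runs_mono[OF this] have "runs ?p (input_tape x # replicate (D + 2 - 1) blank_tape)
        (poly ([:2, 2:] + eval_time \<phi>) (length x)) (Some (sat x (\<lambda>_. 0) \<phi>))
        (tapes (Suc (Suc D)) x (\<lambda>_. 0))" by simp
    then show "\<exists>Ts'. runs ?p (input_tape x # replicate (D + 2 - 1) blank_tape)
        (poly ([:2, 2:] + eval_time \<phi>) (length x)) (Some (x \<in> {w. sat w (\<lambda>_. 0) \<phi>})) Ts'"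
      by auto
  qed simp
qed


section \<open>Semi-uniform equivalence\<close>

text \<open>That \<open>J\<close> satisfies the GL-reduct, with respect to \<open>I\<close>, of the
  rules satisfied by \<open>I\<close>, stated without forming the reduct.\<close>

definition red_sat :: "'a rule set \<Rightarrow> 'a literal set \<Rightarrow> 'a literal set \<Rightarrow> bool" where
  "red_sat \<Pi> I J \<longleftrightarrow>
     (\<forall>r\<in>\<Pi>. sat_rule I r \<and> neg_body r \<inter> I = {} \<and> pos_body r \<subseteq> J \<longrightarrow> head r \<inter> J \<noteq> {})"

definition lits :: "'a rule set \<Rightarrow> 'a literal set" where
  "lits \<Pi> = (\<Union>r\<in>\<Pi>. head r \<union> pos_body r \<union> neg_body r)"

definition witness :: "'a rule set \<Rightarrow> 'a rule set \<Rightarrow> 'a literal set \<Rightarrow> 'a literal set \<Rightarrow> bool" where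
  "witness \<Pi> \<Pi>' I J \<longleftrightarrow> interpretation_lits I \<and> J \<subset> I \<and> red_sat \<Pi>' I J \<and>
     (\<forall>K. J \<subseteq> K \<and> K \<subset> I \<longrightarrow> \<not> red_sat \<Pi> I K)"

lemma sat_prog_reduct: "sat_prog J (gl_reduct {r \<in> \<Pi>. sat_rule I r} I) \<longleftrightarrow> red_sat \<Pi> I J"
proof -
  have "gl_reduct {r \<in> \<Pi>. sat_rule I r} I =
      (\<lambda>r. Rule (head_lits r) (pos_lits r) []) ` {r \<in> \<Pi>. sat_rule I r \<and> neg_body r \<inter> I = {}}"
    by (auto simp: gl_reduct_def)
  moreover have "sat_rule J (Rule (head_lits r) (pos_lits r) []) \<longleftrightarrow>
      (pos_body r \<subseteq> J \<longrightarrow> head r \<inter> J \<noteq> {})" for r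
    by (simp add: sat_rule_def head_def pos_body_def neg_body_def)
  ultimately show ?thesis unfolding sat_prog_def red_sat_def by (simp, blast)
qed

text \<open>Only rules satisfied by \<open>I\<close> enter the reduct. Hence being a stable model
  reduces to consistency and minimality.\<close>

lemma red_sat_refl: "red_sat \<Pi> I I"
  by (auto simp: red_sat_def sat_rule_def)

lemma red_sat_Un: "red_sat (\<Pi> \<union> \<Pi>') I J \<longleftrightarrow> red_sat \<Pi> I J \<and> red_sat \<Pi>' I J"
  by (auto simp: red_sat_def)

lemma unweighted_Un: "unweighted (P \<union> Q) = unweighted P \<union> unweighted Q"
  by (auto simp: unweighted_def)

lemma in_SM_iff:
  "I \<in> SM P \<longleftrightarrow> interpretation_lits I \<and> (\<forall>J. J \<subset> I \<longrightarrow> \<not> red_sat (unweighted P) I J)"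
proof -
  have "unweighted (sat_part P I) = {r \<in> unweighted P. sat_rule I r}"
    by (auto simp: unweighted_def sat_part_def)
  then show ?thesis by (simp add: SM_def asp_stable_def sat_prog_reduct red_sat_refl)
qed

text \<open>Rules see only their own literals. This allows a separating interpretation, which may
  contain literals of the added facts, to be cut down to a finite set \<open>U\<close>.\<close>

lemma red_sat_cong:
  assumes "lits \<Pi> \<subseteq> U" "I \<inter> U = I' \<inter> U" "J \<inter> U = J' \<inter> U"
  shows "red_sat \<Pi> I J \<longleftrightarrow> red_sat \<Pi> I' J'"
proof -
  have "(S \<inter> I = {}) = (S \<inter> I' = {})" "(S \<inter> J = {}) = (S \<inter> J' = {})"
    "(S \<subseteq> I) = (S \<subseteq> I')" "(S \<subseteq> J) = (S \<subseteq> J')" if "S \<subseteq> U" for S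
    using assms(2,3) that by blast+
  moreover have "head r \<subseteq> U" "pos_body r \<subseteq> U" "neg_body r \<subseteq> U" if "r \<in> \<Pi>" for r
    using assms(1) that by (auto simp: lits_def)
  ultimately show ?thesis unfolding red_sat_def sat_rule_def by simp
qed

text \<open>Facts have no bodies, and meeting a head is preserved by larger sets. So facts satisfied
  by \<open>J\<close> exclude no set above \<open>J\<close>, and disjunctions separate no more than
  the elements of \<open>J\<close> as single facts.\<close>

lemma red_sat_facts_mono:
  assumes "\<forall>r\<in>\<Pi>. is_fact r" "red_sat \<Pi> I J" "J \<subseteq> K"
  shows "red_sat \<Pi> I K"
  using assms unfolding red_sat_def is_fact_def by blast

lemma witness_if_separated:
  assumes "weighted_facts R" "I \<in> SM (P \<union> R)" "I \<notin> SM (Q \<union> R)"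
    and U: "lits (unweighted P) \<subseteq> U" "lits (unweighted Q) \<subseteq> U"
  shows "\<exists>I J. I \<subseteq> U \<and> witness (unweighted P) (unweighted Q) I J"
proof -
  have facts: "\<forall>r\<in>unweighted R. is_fact r"
    using assms(1) by (auto simp: unweighted_def weighted_facts_def)
  have I: "interpretation_lits I" and
    P: "\<And>K. K \<subset> I \<Longrightarrow> red_sat (unweighted R) I K \<Longrightarrow> \<not> red_sat (unweighted P) I K"
    using assms(2) by (auto simp: in_SM_iff unweighted_Un red_sat_Un)
  obtain J where J: "J \<subset> I" "red_sat (unweighted Q) I J" "red_sat (unweighted R) I J"
    using assms(3) I by (auto simp: in_SM_iff unweighted_Un red_sat_Un)
  have notP: "\<not> red_sat (unweighted P) I K" if "J \<subseteq> K" "K \<subset> I" for K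
    using P[OF that(2)] red_sat_facts_mono[OF facts J(3) that(1)] by blast
  have "witness (unweighted P) (unweighted Q) (I \<inter> U) (J \<inter> U)"
    unfolding witness_def
  proof (intro conjI allI impI)
    show "interpretation_lits (I \<inter> U)" using I by (auto simp: interpretation_lits_def)
    \<comment> \<open>Otherwise the reduct of \<open>P\<close> could not tell \<open>J\<close> from
      \<open>I\<close> and would be satisfied by \<open>J\<close>, against \<open>notP\<close> for
      \<open>K = J\<close>.\<close>
    have "J \<inter> U \<noteq> I \<inter> U"
      using red_sat_cong[OF U(1) refl, of J I I] red_sat_refl notP[OF _ J(1)] by blast
    then show "J \<inter> U \<subset> I \<inter> U" using J(1) by blast
    show "red_sat (unweighted Q) (I \<inter> U) (J \<inter> U)"
      using J(2) red_sat_cong[OF U(2), of I "I \<inter> U" J "J \<inter> U"] by auto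
    fix K
    assume K: "J \<inter> U \<subseteq> K \<and> K \<subset> I \<inter> U"
    \<comment> \<open>Adding the part of \<open>J\<close> outside \<open>U\<close> lifts
      \<open>K\<close> to a set between \<open>J\<close> and \<open>I\<close>, still proper because
      \<open>K\<close> misses an element of \<open>I \<inter> U\<close>.\<close>
    have "\<not> red_sat (unweighted P) I (K \<union> (J - U))"
      by (rule notP) (use K J(1) in blast)+
    moreover have "(K \<union> (J - U)) \<inter> U = K \<inter> U" by blast
    ultimately show "\<not> red_sat (unweighted P) (I \<inter> U) K"
      using red_sat_cong[OF U(1), of I "I \<inter> U" "K \<union> (J - U)" K] by auto
  qed
  then show ?thesis by blast
qed

text \<open>All added facts hold in \<open>I\<close>, so they stay in the reduct, where together
  they demand exactly \<open>J \<subseteq> K\<close>.\<close>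

lemma separated_if_witness:
  assumes "witness (unweighted P) (unweighted Q) I J" "finite I"
  shows "\<exists>R. finite R \<and> weighted_facts R \<and> I \<in> SM (P \<union> R) \<and> I \<notin> SM (Q \<union> R)"
proof -
  let ?R = "(\<lambda>l. (Alpha, Rule [l] [] [])) ` J"
  have R: "unweighted ?R = (\<lambda>l. Rule [l] [] []) ` J" by (auto simp: unweighted_def)
  have J: "J \<subset> I" using assms(1) by (simp add: witness_def)
  have red: "red_sat (unweighted ?R) I K \<longleftrightarrow> J \<subseteq> K" for K
    unfolding R using J
    by (auto simp: red_sat_def sat_rule_def head_def pos_body_def neg_body_def)
  have "finite ?R" "weighted_facts ?R"
    using assms(2) J finite_subset[of J I]
    by (auto simp: weighted_facts_def is_fact_def pos_body_def neg_body_def)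
  moreover have "I \<in> SM (P \<union> ?R)" "I \<notin> SM (Q \<union> ?R)"
    using assms(1) unfolding in_SM_iff unweighted_Un red_sat_Un red witness_def by blast+
  ultimately show ?thesis by blast
qed

theorem not_semi_uniformly_equivalent_iff:
  assumes "finite U" "lits (unweighted P) \<subseteq> U" "lits (unweighted Q) \<subseteq> U"
  shows "\<not> semi_uniformly_equivalent P Q \<longleftrightarrow>
    (\<exists>I J. I \<subseteq> U \<and> (witness (unweighted P) (unweighted Q) I J \<or> witness (unweighted Q) (unweighted P) I J))"
    (is "?l \<longleftrightarrow> ?r")
proof
  assume ?l
  then obtain R I where "weighted_facts R"
    "I \<in> SM (P \<union> R) \<and> I \<notin> SM (Q \<union> R) \<or> I \<in> SM (Q \<union> R) \<and> I \<notin> SM (P \<union> R)"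
    unfolding semi_uniformly_equivalent_def by blast
  then show ?r
    using witness_if_separated[of R I P Q U] witness_if_separated[of R I Q P U] assms by blast
next
  assume ?r
  then obtain I J where "finite I"
    "witness (unweighted P) (unweighted Q) I J \<or> witness (unweighted Q) (unweighted P) I J"
    using assms(1) finite_subset by blast
  then show ?l
    using separated_if_witness[of P Q I J] separated_if_witness[of Q P I J]
    unfolding semi_uniformly_equivalent_def by blast
qed


section \<open>A finite automaton that reads instances\<close>

datatype part = Head_Part | Pos_Part | Neg_Part

text \<open>The phase names what the next letter means. The boolean is \<open>False\<close> in the
  first program and \<open>True\<close> in the second. \<open>Prog\<close>, \<open>Lits\<close>,
  \<open>Weight_Word\<close> and \<open>Atom\<close> expect the letter that announces a further
  element or the end; \<open>Sign\<close> expects the sign of a literal.\<close>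

datatype phase =
    Prog bool
  | Weight bool
  | Weight_Word bool
  | Weight_Bit bool
  | Lits bool part
  | Sign bool part
  | Atom bool part
  | Atom_Bit bool part
  | Done
  | Err

instance part :: finite
proof
  have "(UNIV :: part set) \<subseteq> {Head_Part, Pos_Part, Neg_Part}"
  proof
    fix k :: part show "k \<in> {Head_Part, Pos_Part, Neg_Part}" by (cases k) auto
  qed
  then show "finite (UNIV :: part set)" by (rule finite_subset) simp
qed

instance phase :: finite
proof
  have "(UNIV :: phase set) \<subseteq> range Prog \<union> range Weight \<union> range Weight_Word \<union> range Weight_Bit \<union>
      range (case_prod Lits) \<union> range (case_prod Sign) \<union> range (case_prod Atom) \<union>
      range (case_prod Atom_Bit) \<union> {Done, Err}" (is "_ \<subseteq> ?S")
  proof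
    fix ph :: phase show "ph \<in> ?S" by (cases ph) (auto simp: image_iff)
  qed
  then show "finite (UNIV :: phase set)" by (rule finite_subset) simp
qed

fun phase_step :: "phase \<Rightarrow> bool \<Rightarrow> phase" where
  "phase_step (Prog b) x = (if x then Weight b else if b then Done else Prog True)"
| "phase_step (Weight b) x = (if x then Weight_Word b else Lits b Head_Part)"
| "phase_step (Weight_Word b) x = (if x then Weight_Bit b else Lits b Head_Part)"
| "phase_step (Weight_Bit b) x = Weight_Word b"
| "phase_step (Lits b k) x = (if x then Sign b k else
     case k of Head_Part \<Rightarrow> Lits b Pos_Part | Pos_Part \<Rightarrow> Lits b Neg_Part | Neg_Part \<Rightarrow> Prog b)"
| "phase_step (Sign b k) x = Atom b k"
| "phase_step (Atom b k) x = (if x then Atom_Bit b k else Lits b k)"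
| "phase_step (Atom_Bit b k) x = Atom b k"
| "phase_step Done x = Err"
| "phase_step Err x = Err"

text \<open>
  Besides the phase, the automaton remembers which labels occur in each part of the current rule,
  and, for both programs, this information for all rules that have been completed.
\<close>

type_synonym 'm memory = "(part \<Rightarrow> 'm set) \<times> (bool \<Rightarrow> (part \<Rightarrow> 'm set) set)"

text \<open>A label is consulted only at the sign of a literal. The end of the negative body is the
  end of the rule: the collected sets are stored and \<open>c\<close> is emptied.\<close>

fun mem_step :: "phase \<Rightarrow> bool \<Rightarrow> 'm \<Rightarrow> 'm memory \<Rightarrow> 'm memory" where
  "mem_step (Sign b k) x m (c, A) = (c(k := insert m (c k)), A)"
| "mem_step (Lits b Neg_Part) False m (c, A) = (\<lambda>_. {}, A(b := insert c (A b)))"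
| "mem_step ph x m cA = cA"

fun scan_step :: "phase \<times> 'm memory \<Rightarrow> bool \<times> 'm \<Rightarrow> phase \<times> 'm memory" where
  "scan_step (ph, cA) (x, m) = (phase_step ph x, mem_step ph x m cA)"

definition scan_start :: "phase \<times> 'm memory" where
  "scan_start = (Prog False, \<lambda>_. {}, \<lambda>_. {})"

fun rule_part :: "'a rule \<Rightarrow> part \<Rightarrow> 'a literal set" where
  "rule_part r Head_Part = head r"
| "rule_part r Pos_Part = pos_body r"
| "rule_part r Neg_Part = neg_body r"

lemma fst_scan: "fst (foldl scan_step s zs) = foldl phase_step (fst s) (map fst zs)"
proof (induction zs arbitrary: s)
  case (Cons z zs)
  have "fst (scan_step s z) = phase_step (fst s) (fst z)" by (cases s; cases z) simp
  then show ?case using Cons by simp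
qed simp

text \<open>At most one \<open>l\<close> qualifies at each sign, since the code of literals is
  self-delimiting; labels at other positions are unconstrained.\<close>

primrec labelled :: "(atom literal \<Rightarrow> 'm) \<Rightarrow> phase \<Rightarrow> (bool \<times> 'm) list \<Rightarrow> bool" where
  "labelled M ph [] = True"
| "labelled M ph (z # zs) \<longleftrightarrow>
     (\<forall>b k l u. ph = Sign b k \<and> fst z # map fst zs = enc_literal l @ u \<longrightarrow> snd z = M l) \<and>
     labelled M (phase_step ph (fst z)) zs"

lemma labelled_iff:
  "labelled M ph zs \<longleftrightarrow> (\<forall>p < length zs. \<forall>b k l u. foldl phase_step ph (take p (map fst zs)) = Sign b k \<and>
     drop p (map fst zs) = enc_literal l @ u \<longrightarrow> snd (zs ! p) = M l)"
proof (induction zs arbitrary: ph)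
  case (Cons z zs)
  show ?case by (simp add: Cons All_less_Suc2)
qed simp

text \<open>Reading \<open>u\<close> leads from \<open>s\<close> to \<open>s'\<close>, whatever
  follows. The labels inside \<open>u\<close> are only partly determined, so the statement
  quantifies over all admissible labellings and hands the labelled rest on to the next piece, which
  makes it composable.\<close>

definition transfers ::
  "(atom literal \<Rightarrow> 'm) \<Rightarrow> bool list \<Rightarrow> phase \<times> 'm memory \<Rightarrow> phase \<times> 'm memory \<Rightarrow> bool" where
  "transfers M u s s' \<longleftrightarrow> (\<forall>zs v. map fst zs = u @ v \<and> labelled M (fst s) zs \<longrightarrow>
     (\<exists>zs'. map fst zs' = v \<and> labelled M (fst s') zs' \<and>
       foldl scan_step s zs = foldl scan_step s' zs'))"

lemma transfers_append:
  assumes "transfers M u s s'" "transfers M u' s' s''"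
  shows "transfers M (u @ u') s s''"
  unfolding transfers_def
proof (intro allI impI)
  fix zs v
  assume "map fst zs = (u @ u') @ v \<and> labelled M (fst s) zs"
  then obtain zs1 where 1: "map fst zs1 = u' @ v" "labelled M (fst s') zs1"
    "foldl scan_step s zs = foldl scan_step s' zs1"
    using assms(1)[unfolded transfers_def, rule_format, of zs "u' @ v"] by auto
  then obtain zs2 where "map fst zs2 = v" "labelled M (fst s'') zs2"
    "foldl scan_step s' zs1 = foldl scan_step s'' zs2"
    using assms(2)[unfolded transfers_def, rule_format, of zs1 v] by auto
  with 1 show "\<exists>zs'. map fst zs' = v \<and> labelled M (fst s'') zs' \<and>
       foldl scan_step s zs = foldl scan_step s'' zs'" by auto
qed

lemma transfers_single:
  assumes "\<And>m. mem_step ph x m cA = cA'"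
  shows "transfers M [x] (ph, cA) (phase_step ph x, cA')"
  unfolding transfers_def
proof (intro allI impI)
  fix zs :: "(bool \<times> 'a) list" and v
  assume a: "map fst zs = [x] @ v \<and> labelled M (fst (ph, cA)) zs"
  then obtain m zs' where "zs = (x, m) # zs'" by (cases zs) auto
  with a assms show "\<exists>zs'. map fst zs' = v \<and> labelled M (fst (phase_step ph x, cA')) zs' \<and>
      foldl scan_step (ph, cA) zs = foldl scan_step (phase_step ph x, cA') zs'"
    by auto
qed

lemma transfers_Cons:
  assumes "\<And>m. mem_step ph x m cA = cA'" "transfers M u (phase_step ph x, cA') s"
  shows "transfers M (x # u) (ph, cA) s"
  using transfers_append[OF transfers_single[OF assms(1)] assms(2)] by simp

lemma enc_word_simps: "enc_word [] = [False]" "enc_word (x # a) = True # x # enc_word a"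
  by (simp_all add: enc_word_def enc_list_def)

lemma enc_list_simps: "enc_list f [] = [False]" "enc_list f (x # xs) = True # f x @ enc_list f xs"
  by (simp_all add: enc_list_def)

lemma transfers_atom: "transfers M (enc_word a) (Atom b k, cA) (Lits b k, cA)"
proof (induction a)
  case Nil
  show ?case using transfers_single[of "Atom b k" False cA cA M] by (simp add: enc_word_simps)
next
  case (Cons x a)
  show ?case unfolding enc_word_simps
    by (intro transfers_Cons[where cA' = cA]) (use Cons in simp_all)
qed

lemma transfers_weight_word: "transfers M (enc_word a) (Weight_Word b, cA) (Lits b Head_Part, cA)"
proof (induction a)
  case Nil
  show ?case using transfers_single[of "Weight_Word b" False cA cA M] by (simp add: enc_word_simps)
next
  case (Cons x a)
  show ?case unfolding enc_word_simps
    by (intro transfers_Cons[where cA' = cA]) (use Cons in simp_all)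
qed

lemma transfers_literal:
  "transfers M (enc_literal l) (Sign b k, c, A) (Lits b k, c(k := insert (M l) (c k)), A)"
proof -
  obtain x a where l: "enc_literal l = x # enc_word a" by (cases l) auto
  show ?thesis
    unfolding transfers_def
  proof (intro allI impI)
    fix zs :: "(bool \<times> 'a) list" and v
    assume a: "map fst zs = enc_literal l @ v \<and> labelled M (fst (Sign b k, c, A)) zs"
    then obtain m zs' where zs: "zs = (x, m) # zs'" "map fst zs' = enc_word a @ v"
      by (cases zs) (auto simp: l)
    have m: "m = M l" and zs': "labelled M (Atom b k) zs'"
      using a zs by (auto simp: l)
    show "\<exists>zs'. map fst zs' = v \<and> labelled M (fst (Lits b k, c(k := insert (M l) (c k)), A)) zs' \<and>
        foldl scan_step (Sign b k, c, A) zs =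
        foldl scan_step (Lits b k, c(k := insert (M l) (c k)), A) zs'"
      using transfers_atom[unfolded transfers_def, rule_format, of zs' a v M b k "(c(k := insert m (c k)), A)"]
        zs zs' m by simp
  qed
qed

text \<open>The three parts continue differently, and the last one also stores the rule, so the
  target is expressed by the step itself. \<open>undefined\<close> stands for a label that is not
  consulted in this phase.\<close>

lemma transfers_lits:
  "transfers M (enc_list enc_literal ls) (Lits b k, c, A)
    (phase_step (Lits b k) False,
     mem_step (Lits b k) False undefined (c(k := M ` set ls \<union> c k), A))"
proof (induction ls arbitrary: c)
  case Nil
  have "mem_step (Lits b k) False m (c, A) = mem_step (Lits b k) False undefined (c, A)" for m
    by (cases k) simp_all
  from transfers_single[OF this, of M] show ?case by (simp add: enc_list_simps)
next
  case (Cons l ls)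
  have 1: "c(k := insert (M l) (c k), k := M ` set ls \<union> (c(k := insert (M l) (c k))) k) =
      c(k := M ` set (l # ls) \<union> c k)" by simp
  have "transfers M (True # enc_literal l @ enc_list enc_literal ls) (Lits b k, c, A)
      (phase_step (Lits b k) False,
       mem_step (Lits b k) False undefined (c(k := M ` set (l # ls) \<union> c k), A))"
  proof (rule transfers_Cons)
    show "transfers M (enc_literal l @ enc_list enc_literal ls) (phase_step (Lits b k) True, c, A)
      (phase_step (Lits b k) False,
       mem_step (Lits b k) False undefined (c(k := M ` set (l # ls) \<union> c k), A))"
      using transfers_append[OF transfers_literal Cons[of "c(k := insert (M l) (c k))", unfolded 1]]
      by (simp add: fun_upd_def)
  qed simp
  then show ?case by (simp add: enc_list_simps fun_upd_def)
qed

lemma transfers_rule: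
  "transfers M (enc_rule r) (Lits b Head_Part, \<lambda>_. {}, A)
    (Prog b, \<lambda>_. {}, A(b := insert (\<lambda>k. M ` rule_part r k) (A b)))"
proof (cases r)
  case (Rule hs ps ns)
  let ?c = "((\<lambda>_. {})(Head_Part := M ` set hs, Pos_Part := M ` set ps, Neg_Part := M ` set ns))"
  have "?c k = M ` rule_part r k" for k
    by (cases k) (simp_all add: Rule head_def pos_body_def neg_body_def)
  then have c: "?c = (\<lambda>k. M ` rule_part r k)" by blast
  have "transfers M (enc_list enc_literal hs @ enc_list enc_literal ps @ enc_list enc_literal ns)
      (Lits b Head_Part, \<lambda>_. {}, A) (Prog b, \<lambda>_. {}, A(b := insert ?c (A b)))"
  proof (intro transfers_append)
    show "transfers M (enc_list enc_literal hs) (Lits b Head_Part, \<lambda>_. {}, A)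
        (Lits b Pos_Part, (\<lambda>_. {})(Head_Part := M ` set hs), A)"
      using transfers_lits[of M hs b Head_Part "\<lambda>_. {}" A] by simp
    show "transfers M (enc_list enc_literal ps) (Lits b Pos_Part, (\<lambda>_. {})(Head_Part := M ` set hs), A)
        (Lits b Neg_Part, (\<lambda>_. {})(Head_Part := M ` set hs, Pos_Part := M ` set ps), A)"
      using transfers_lits[of M ps b Pos_Part "(\<lambda>_. {})(Head_Part := M ` set hs)" A] by simp
    show "transfers M (enc_list enc_literal ns)
        (Lits b Neg_Part, (\<lambda>_. {})(Head_Part := M ` set hs, Pos_Part := M ` set ps), A)
        (Prog b, \<lambda>_. {}, A(b := insert ?c (A b)))"
      using transfers_lits[of M ns b Neg_Part
          "(\<lambda>_. {})(Head_Part := M ` set hs, Pos_Part := M ` set ps)" A] by simp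
  qed
  then show ?thesis unfolding c by (simp add: Rule)
qed

lemma transfers_wrule:
  "transfers M (enc_wrule wr) (Weight b, \<lambda>_. {}, A)
    (Prog b, \<lambda>_. {}, A(b := insert (\<lambda>k. M ` rule_part (snd wr) k) (A b)))"
proof -
  obtain w r where wr: "wr = (w, r)" by fastforce
  have "transfers M (enc_weight w) (Weight b, \<lambda>_. {}, A) (Lits b Head_Part, \<lambda>_. {}, A)"
  proof (cases w)
    case Alpha
    then show ?thesis using transfers_single[of "Weight b" False "(\<lambda>_. {}, A)"] by simp
  next
    case (Soft u)
    show ?thesis unfolding Soft enc_weight.simps
      by (rule transfers_Cons) (use transfers_weight_word in simp_all)
  qed
  from transfers_append[OF this transfers_rule] show ?thesis by (simp add: wr)
qed

lemma transfers_prog: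
  "transfers M (enc_list enc_wrule p) (Prog b, \<lambda>_. {}, A)
    (phase_step (Prog b) False, \<lambda>_. {}, A(b := (\<lambda>r k. M ` rule_part r k) ` snd ` set p \<union> A b))"
proof (induction p arbitrary: A)
  case Nil
  show ?case using transfers_single[of "Prog b" False "(\<lambda>_. {}, A)" _ M] by (simp add: enc_list_simps)
next
  case (Cons wr p)
  let ?A = "A(b := insert (\<lambda>k. M ` rule_part (snd wr) k) (A b))"
  have 1: "?A(b := (\<lambda>r k. M ` rule_part r k) ` snd ` set p \<union> ?A b) =
      A(b := (\<lambda>r k. M ` rule_part r k) ` snd ` set (wr # p) \<union> A b)" by simp
  show ?case unfolding enc_list_simps
  proof (rule transfers_Cons)
    show "transfers M (enc_wrule wr @ enc_list enc_wrule p) (phase_step (Prog b) True, \<lambda>_. {}, A)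
      (phase_step (Prog b) False, \<lambda>_. {}, A(b := (\<lambda>r k. M ` rule_part r k) ` snd ` set (wr # p) \<union> A b))"
      using transfers_append[OF transfers_wrule Cons[of ?A, unfolded 1]]
      by (simp add: fun_upd_def)
  qed simp
qed

text \<open>Order and multiplicity of rules are forgotten and literals with equal labels are merged,
  which leaves finitely many values if there are finitely many labels.\<close>

definition abstract :: "(atom literal \<Rightarrow> 'm) \<Rightarrow> input_prog \<Rightarrow> (part \<Rightarrow> 'm set) set" where
  "abstract M p = (\<lambda>r k. M ` rule_part r k) ` snd ` set p"

lemma scan_instance:
  assumes "map fst zs = enc_instance p q" "labelled M (Prog False) zs"
  shows "foldl scan_step scan_start zs =
    (Done, \<lambda>_. {}, \<lambda>b. if b then abstract M q else abstract M p)"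
proof -
  let ?A = "(\<lambda>_. {})(False := abstract M p)"
  have "transfers M (enc_instance p q) scan_start (Done, \<lambda>_. {}, ?A(True := abstract M q))"
    unfolding enc_instance_def
  proof (rule transfers_append)
    show "transfers M (enc_list enc_wrule p) scan_start (Prog True, \<lambda>_. {}, ?A)"
      using transfers_prog[of M p False "\<lambda>_. {}"] by (simp add: scan_start_def abstract_def)
    show "transfers M (enc_list enc_wrule q) (Prog True, \<lambda>_. {}, ?A) (Done, \<lambda>_. {}, ?A(True := abstract M q))"
      using transfers_prog[of M q True ?A] by (simp add: abstract_def)
  qed
  from this[unfolded transfers_def, rule_format, of zs "[]"] assms
  have "foldl scan_step scan_start zs = (Done, \<lambda>_. {}, ?A(True := abstract M q))"
    by (auto simp: scan_start_def)
  moreover have "?A(True := abstract M q) = (\<lambda>b. if b then abstract M q else abstract M p)"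
    by (simp add: fun_eq_iff)
  ultimately show ?thesis by simp
qed

text \<open>Phases do not depend on labels, so labels from a one-element type, for which
  \<open>labelled\<close> is trivial, reduce this to \<open>scan_instance\<close>.\<close>

lemma phase_enc_instance: "foldl phase_step (Prog False) (enc_instance p q) = Done"
proof -
  let ?zs = "map (\<lambda>x. (x, ())) (enc_instance p q)"
  have zs: "map fst ?zs = enc_instance p q" by (simp add: o_def)
  have "labelled (\<lambda>_. ()) (Prog False) ?zs" by (simp add: labelled_iff)
  from arg_cong[OF scan_instance[OF zs this], of fst] show ?thesis
    unfolding fst_scan zs by (simp add: scan_start_def)
qed


subsection \<open>Only instances are accepted\<close>

lemma parse_atom:
  "foldl phase_step (Atom b k) x = Done \<Longrightarrow>
   \<exists>a u. x = enc_word a @ u \<and> foldl phase_step (Lits b k) u = Done"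
proof (induction x rule: induct_list012)
  case (2 c)
  then show ?case by (auto simp: enc_word_simps split: if_splits intro!: exI[of _ "[]"])
next
  case (3 c d x)
  show ?case
  proof (cases c)
    case True
    with 3 obtain a u where "x = enc_word a @ u" "foldl phase_step (Lits b k) u = Done" by auto
    then show ?thesis using True by (intro exI[of _ "d # a"] exI[of _ u]) (simp add: enc_word_simps)
  next
    case False
    then show ?thesis using 3 by (intro exI[of _ "[]"] exI[of _ "d # x"]) (simp add: enc_word_simps)
  qed
qed simp

lemma parse_weight_word:
  "foldl phase_step (Weight_Word b) x = Done \<Longrightarrow>
   \<exists>a u. x = enc_word a @ u \<and> foldl phase_step (Lits b Head_Part) u = Done"
proof (induction x rule: induct_list012)
  case (2 c)
  then show ?case by (auto simp: enc_word_simps split: if_splits intro!: exI[of _ "[]"])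
next
  case (3 c d x)
  show ?case
  proof (cases c)
    case True
    with 3 obtain a u where "x = enc_word a @ u" "foldl phase_step (Lits b Head_Part) u = Done" by auto
    then show ?thesis using True by (intro exI[of _ "d # a"] exI[of _ u]) (simp add: enc_word_simps)
  next
    case False
    then show ?thesis using 3 by (intro exI[of _ "[]"] exI[of _ "d # x"]) (simp add: enc_word_simps)
  qed
qed simp

lemma parse_literal:
  assumes "foldl phase_step (Sign b k) x = Done"
  shows "\<exists>l u. x = enc_literal l @ u \<and> foldl phase_step (Lits b k) u = Done"
proof -
  obtain c x' where x: "x = c # x'" using assms by (cases x) auto
  obtain a u where a: "x' = enc_word a @ u" "foldl phase_step (Lits b k) u = Done"
    using assms parse_atom x by fastforce
  show ?thesis
    using a x by (intro exI[of _ "if c then Pos a else Neg a"] exI[of _ u]) auto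
qed

text \<open>Literals have codes of varying length, hence the induction on the length of the
  remaining word.\<close>

lemma parse_lits:
  "foldl phase_step (Lits b k) x = Done \<Longrightarrow>
   \<exists>ls u. x = enc_list enc_literal ls @ u \<and> foldl phase_step (phase_step (Lits b k) False) u = Done"
proof (induction "length x" arbitrary: x rule: less_induct)
  case less
  then obtain c x' where x: "x = c # x'" by (cases x) auto
  show ?case
  proof (cases c)
    case True
    then obtain l u where l: "x' = enc_literal l @ u" "foldl phase_step (Lits b k) u = Done"
      using parse_literal[of b k x'] less.prems x by auto
    moreover have "length u < length x" using l x by simp
    ultimately obtain ls v where "u = enc_list enc_literal ls @ v"
      "foldl phase_step (phase_step (Lits b k) False) v = Done"
      using less.hyps by blast
    then show ?thesis using l x True
      by (intro exI[of _ "l # ls"] exI[of _ v]) (simp add: enc_list_simps)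
  next
    case False
    then show ?thesis using less.prems x
      by (intro exI[of _ "[]"] exI[of _ x']) (simp add: enc_list_simps)
  qed
qed

lemma parse_rule:
  assumes "foldl phase_step (Lits b Head_Part) x = Done"
  shows "\<exists>r u. x = enc_rule r @ u \<and> foldl phase_step (Prog b) u = Done"
proof -
  obtain hs u where u: "x = enc_list enc_literal hs @ u" "foldl phase_step (Lits b Pos_Part) u = Done"
    using parse_lits[OF assms] by auto
  obtain ps v where v: "u = enc_list enc_literal ps @ v" "foldl phase_step (Lits b Neg_Part) v = Done"
    using parse_lits[OF u(2)] by auto
  obtain ns w where w: "v = enc_list enc_literal ns @ w" "foldl phase_step (Prog b) w = Done"
    using parse_lits[OF v(2)] by auto
  show ?thesis using u v w by (intro exI[of _ "Rule hs ps ns"] exI[of _ w]) simp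
qed

lemma parse_wrule:
  assumes "foldl phase_step (Weight b) x = Done"
  shows "\<exists>wr u. x = enc_wrule wr @ u \<and> foldl phase_step (Prog b) u = Done"
proof -
  obtain c x' where x: "x = c # x'" using assms by (cases x) auto
  have "\<exists>w u. x = enc_weight w @ u \<and> foldl phase_step (Lits b Head_Part) u = Done"
  proof (cases c)
    case True
    then obtain a u where "x' = enc_word a @ u" "foldl phase_step (Lits b Head_Part) u = Done"
      using parse_weight_word[of b x'] assms x by auto
    then show ?thesis using x True by (intro exI[of _ "Soft a"] exI[of _ u]) simp
  next
    case False
    then show ?thesis using assms x by (intro exI[of _ Alpha] exI[of _ x']) simp
  qed
  then obtain w u where u: "x = enc_weight w @ u" "foldl phase_step (Lits b Head_Part) u = Done"
    by blast
  obtain r v where "u = enc_rule r @ v" "foldl phase_step (Prog b) v = Done"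
    using parse_rule[OF u(2)] by blast
  then show ?thesis using u by (intro exI[of _ "(w, r)"] exI[of _ v]) simp
qed

lemma parse_prog:
  "foldl phase_step (Prog b) x = Done \<Longrightarrow>
   \<exists>p u. x = enc_list enc_wrule p @ u \<and> foldl phase_step (if b then Done else Prog True) u = Done"
proof (induction "length x" arbitrary: x rule: less_induct)
  case less
  then obtain c x' where x: "x = c # x'" by (cases x) auto
  show ?case
  proof (cases c)
    case True
    then obtain wr u where l: "x' = enc_wrule wr @ u" "foldl phase_step (Prog b) u = Done"
      using parse_wrule[of b x'] less.prems x by auto
    moreover have "length u < length x" using l x by simp
    ultimately obtain p v where "u = enc_list enc_wrule p @ v"
      "foldl phase_step (if b then Done else Prog True) v = Done"
      using less.hyps by blast
    then show ?thesis using l x True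
      by (intro exI[of _ "wr # p"] exI[of _ v]) (simp add: enc_list_simps)
  next
    case False
    then show ?thesis using less.prems x
      by (intro exI[of _ "[]"] exI[of _ x']) (simp add: enc_list_simps)
  qed
qed

lemma parse_instance:
  assumes "foldl phase_step (Prog False) x = Done"
  shows "\<exists>p q. x = enc_instance p q"
proof -
  obtain p u where u: "x = enc_list enc_wrule p @ u" "foldl phase_step (Prog True) u = Done"
    using parse_prog[OF assms] by auto
  obtain q v where v: "u = enc_list enc_wrule q @ v" "foldl phase_step Done v = Done"
    using parse_prog[OF u(2)] by auto
  \<comment> \<open>Every letter after \<open>Done\<close> leads to \<open>Err\<close> for good, so
    nothing can follow the second program.\<close>
  have "foldl phase_step Err v' = Err" for v' by (induction v') auto
  with v(2) have "v = []" by (cases v) auto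
  with u v show ?thesis by (auto simp: enc_instance_def)
qed


section \<open>Checking a witness\<close>

type_synonym label = "bool \<times> bool \<times> bool"

definition abs_red :: "(part \<Rightarrow> 'm set) set \<Rightarrow> 'm set \<Rightarrow> 'm set \<Rightarrow> bool" where
  "abs_red A i j \<longleftrightarrow> (\<forall>c\<in>A.
     (c Pos_Part \<subseteq> i \<and> c Neg_Part \<inter> i = {} \<longrightarrow> c Head_Part \<inter> i \<noteq> {}) \<and>
     c Neg_Part \<inter> i = {} \<and> c Pos_Part \<subseteq> j \<longrightarrow> c Head_Part \<inter> j \<noteq> {})"

text \<open>Inclusions between sets of literals must ignore labels that no literal of the programs
  carries.\<close>

definition seen :: "(bool \<Rightarrow> (part \<Rightarrow> 'm set) set) \<Rightarrow> 'm set" where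
  "seen A = (\<Union>b. \<Union>c\<in>A b. \<Union>k. c k)"

abbreviation lab\<^sub>1 :: "label set" where "lab\<^sub>1 \<equiv> {m. fst m}"
abbreviation lab\<^sub>2 :: "label set" where "lab\<^sub>2 \<equiv> {m. fst (snd m)}"
abbreviation lab\<^sub>3 :: "label set" where "lab\<^sub>3 \<equiv> {m. snd (snd m)}"

text \<open>\<open>A s\<close> belongs to the first program of \<open>witness\<close> and
  \<open>A (\<not> s)\<close> to the second. Consistency of \<open>I\<close> cannot be seen from
  labels alone, as it concerns pairs of literals; \<open>verify\<close> checks it
  separately.\<close>

definition good :: "(bool \<Rightarrow> (part \<Rightarrow> label set) set) \<Rightarrow> bool \<Rightarrow> bool" where
  "good A s \<longleftrightarrow>
     seen A \<inter> lab\<^sub>2 \<subset> seen A \<inter> lab\<^sub>1 \<and> abs_red (A (\<not> s)) lab\<^sub>1 lab\<^sub>2 \<and>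
     (seen A \<inter> lab\<^sub>2 \<subseteq> seen A \<inter> lab\<^sub>3 \<and> seen A \<inter> lab\<^sub>3 \<subset> seen A \<inter> lab\<^sub>1 \<longrightarrow>
      \<not> abs_red (A s) lab\<^sub>1 lab\<^sub>3)"

lemma rule_part_UNIV: "(\<Union>k. rule_part r k) = head r \<union> pos_body r \<union> neg_body r"
proof
  have "rule_part r k \<subseteq> head r \<union> pos_body r \<union> neg_body r" for k
    by (cases k) auto
  then show "(\<Union>k. rule_part r k) \<subseteq> head r \<union> pos_body r \<union> neg_body r"
    by (rule UN_least)
  show "head r \<union> pos_body r \<union> neg_body r \<subseteq> (\<Union>k. rule_part r k)"
    using UN_upper[of _ UNIV "rule_part r"] rule_part.simps by (metis UNIV_I Un_least)
qed

text \<open>For preimages under \<open>M\<close>, intersection with and inclusion of a set of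
  literals can be tested on its image.\<close>

lemma abs_red_abstract:
  "abs_red (abstract M p) i j \<longleftrightarrow> red_sat (snd ` set p) (M -` i) (M -` j)"
proof -
  have "M ` H \<inter> i = {} \<longleftrightarrow> H \<inter> M -` i = {}" "M ` H \<subseteq> i \<longleftrightarrow> H \<subseteq> M -` i" for H i
    by auto
  then show ?thesis by (simp add: abs_red_def abstract_def red_sat_def sat_rule_def)
qed

lemma good_iff:
  fixes M :: "atom literal \<Rightarrow> label" and p q :: input_prog
  defines "\<Pi> \<equiv> \<lambda>b. snd ` set (if b then q else p)"
  defines "U \<equiv> \<Union>b. lits (\<Pi> b)"
  assumes I: "I = M -` lab\<^sub>1 \<inter> U" and J: "J = M -` lab\<^sub>2 \<inter> U" and K: "K = M -` lab\<^sub>3 \<inter> U"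
  shows "good (\<lambda>b. abstract M (if b then q else p)) s \<longleftrightarrow>
    J \<subset> I \<and> red_sat (\<Pi> (\<not> s)) I J \<and> (J \<subseteq> K \<and> K \<subset> I \<longrightarrow> \<not> red_sat (\<Pi> s) I K)"
proof -
  let ?A = "\<lambda>b. abstract M (if b then q else p)"
  have "seen ?A = (\<Union>b. \<Union>r\<in>\<Pi> b. \<Union>k. M ` rule_part r k)"
    by (simp add: seen_def abstract_def \<Pi>_def)
  then have seen: "seen ?A = M ` U"
    by (simp only: U_def lits_def image_UN flip: rule_part_UNIV)
  have red: "abs_red (?A b) i j \<longleftrightarrow> red_sat (\<Pi> b) (M -` i \<inter> U) (M -` j \<inter> U)" for b i j
    unfolding abs_red_abstract \<Pi>_def
    by (rule red_sat_cong[where U = U]) (auto simp: U_def \<Pi>_def)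
  have sub: "M ` U \<inter> i \<subseteq> M ` U \<inter> j \<longleftrightarrow> M -` i \<inter> U \<subseteq> M -` j \<inter> U" for i j
    by auto
  then have "M ` U \<inter> i \<subset> M ` U \<inter> j \<longleftrightarrow> M -` i \<inter> U \<subset> M -` j \<inter> U" for i j
    by (simp only: less_le_not_le)
  then show ?thesis unfolding good_def seen red sub I J K by (simp only:)
qed

text \<open>\<open>p\<close> and \<open>q\<close> are positions of signs, and \<open>l\<close> is
  the length of the atom. Its code alternates between markers and letters and ends with a
  \<open>False\<close> marker; comparing the markers as well forces equal lengths.\<close>

definition same_atom :: "bool list \<Rightarrow> nat \<Rightarrow> nat \<Rightarrow> bool" where
  "same_atom x p q \<longleftrightarrow> (\<exists>l. p + 1 + 2 * l < length x \<and> q + 1 + 2 * l < length x \<and>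
     \<not> x ! (p + 1 + 2 * l) \<and> (\<forall>j<l. x ! (p + 1 + 2 * j)) \<and>
     (\<forall>d \<le> 2 * l. x ! (p + 1 + d) = x ! (q + 1 + d)))"

definition run_on :: "bool list \<Rightarrow> (nat \<Rightarrow> 'm) \<Rightarrow> (nat \<Rightarrow> phase \<times> 'm memory) \<Rightarrow> bool" where
  "run_on x L S \<longleftrightarrow> S 0 = scan_start \<and> (\<forall>p < length x. S (Suc p) = scan_step (S p) (x ! p, L p))"

definition is_sign :: "phase \<Rightarrow> bool" where
  "is_sign ph \<longleftrightarrow> (\<exists>b k. ph = Sign b k)"

definition same_atoms_respect ::
  "bool list \<Rightarrow> (nat \<Rightarrow> phase) \<Rightarrow> (nat \<Rightarrow> nat \<Rightarrow> bool) \<Rightarrow> bool" where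
  "same_atoms_respect x ph R \<longleftrightarrow> (\<forall>p < length x. \<forall>q < length x.
     is_sign (ph p) \<and> is_sign (ph q) \<and> same_atom x p q \<longrightarrow> R p q)"

text \<open>
  The labels \<open>i\<close> and \<open>j\<close> are the sets \<open>I\<close> and \<open>J\<close> of a witness, given by one bit for every
  occurrence of a literal; \<open>i (length x)\<close> says for which of the two orders of the programs it is a
  witness.  The labels \<open>k\<close> are the universally quantified set \<open>K\<close>, and \<open>S\<close> is the run of the
  automaton, which is unique and hence can be quantified universally as well.
\<close>

definition verify ::
  "bool list \<Rightarrow> (nat \<Rightarrow> bool) \<Rightarrow> (nat \<Rightarrow> bool) \<Rightarrow> (nat \<Rightarrow> bool) \<Rightarrow> (nat \<Rightarrow> phase \<times> label memory) \<Rightarrow> bool" where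
  "verify x i j k S \<longleftrightarrow>
     run_on x (\<lambda>p. (i p, j p, k p)) S \<longrightarrow> fst (S (length x)) = Done \<longrightarrow>
       same_atoms_respect x (\<lambda>p. fst (S p))
         (\<lambda>p q. if x ! p = x ! q then i p = i q \<and> j p = j q else \<not> (i p \<and> i q)) \<and>
       (same_atoms_respect x (\<lambda>p. fst (S p)) (\<lambda>p q. x ! p = x ! q \<longrightarrow> k p = k q) \<longrightarrow>
        good (snd (snd (S (length x)))) (i (length x)))"

section \<open>Codes of atoms at given positions\<close>

lemma enc_word_nth: "j < length a \<Longrightarrow> enc_word a ! (2 * j)"
proof (induction a arbitrary: j)
  case (Cons x a)
  then show ?case by (cases j) (auto simp: enc_word_simps)
qed simp

lemma length_enc_word: "length (enc_word a) = 2 * length a + 1"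
  by (induction a) (auto simp: enc_word_simps)

lemma enc_word_nth_end: "\<not> enc_word a ! (2 * length a)"
  by (induction a) (auto simp: enc_word_simps)

lemma enc_word_nth_bit: "j < length a \<Longrightarrow> enc_word a ! (2 * j + 1) = a ! j"
proof (induction a arbitrary: j)
  case (Cons x a)
  then show ?case by (cases j) (auto simp: enc_word_simps)
qed simp

text \<open>The markers force \<open>l = length a\<close>. Then the code of \<open>a\<close> is a
  prefix of what follows the second sign, and self-delimitation gives \<open>a = b\<close>.\<close>

lemma same_atom_iff:
  assumes "drop p x = c # enc_word a @ u" "drop q x = d # enc_word b @ v"
  shows "same_atom x p q \<longleftrightarrow> a = b"
proof -
  have lp: "length x = p + 1 + length (enc_word a @ u)"
    using arg_cong[OF assms(1), of length] by (simp add: length_enc_word)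
  have lq: "length x = q + 1 + length (enc_word b @ v)"
    using arg_cong[OF assms(2), of length] by (simp add: length_enc_word)
  have xp: "x ! (p + 1 + i) = (enc_word a @ u) ! i" if "i < length (enc_word a @ u)" for i
    using arg_cong[OF assms(1), of "\<lambda>xs. xs ! Suc i"] that lp by simp
  have xq: "x ! (q + 1 + i) = (enc_word b @ v) ! i" if "i < length (enc_word b @ v)" for i
    using arg_cong[OF assms(2), of "\<lambda>xs. xs ! Suc i"] that lq by simp
  show ?thesis
  proof
    assume "same_atom x p q"
    then obtain l where l: "p + 1 + 2 * l < length x" "q + 1 + 2 * l < length x"
      "\<not> x ! (p + 1 + 2 * l)" "\<And>j. j < l \<Longrightarrow> x ! (p + 1 + 2 * j)"
      "\<And>i. i \<le> 2 * l \<Longrightarrow> x ! (p + 1 + i) = x ! (q + 1 + i)"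
      unfolding same_atom_def by blast
    have la: "l = length a"
    proof (rule ccontr)
      assume "l \<noteq> length a"
      then consider "l < length a" | "length a < l" by linarith
      then show False
      proof cases
        case 1
        then show ?thesis using l(3) xp[of "2 * l"] enc_word_nth[OF 1]
          by (simp add: nth_append length_enc_word)
      next
        case 2
        then show ?thesis using l(4)[OF 2] xp[of "2 * length a"] enc_word_nth_end[of a]
          by (simp add: nth_append length_enc_word)
      qed
    qed
    have len: "2 * l + 1 \<le> length (enc_word b @ v)" using l(2) lq by simp
    have "take (2 * l + 1) (enc_word a @ u) = take (2 * l + 1) (enc_word b @ v)"
    proof (rule nth_equalityI)
      show "length (take (2 * l + 1) (enc_word a @ u)) = length (take (2 * l + 1) (enc_word b @ v))"
        using len by (simp add: length_enc_word la)
      fix i assume "i < length (take (2 * l + 1) (enc_word a @ u))"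
      then have i: "i \<le> 2 * l" by simp
      then have "i < length (enc_word a @ u)" "i < length (enc_word b @ v)"
        using len by (simp_all add: la length_enc_word)
      from xp[OF this(1)] xq[OF this(2)] l(5)[OF i] i
      show "take (2 * l + 1) (enc_word a @ u) ! i = take (2 * l + 1) (enc_word b @ v) ! i"
        by (simp del: take_append)
    qed
    then have "enc_word a = take (2 * l + 1) (enc_word b @ v)" by (simp add: la length_enc_word)
    then have "enc_word a @ drop (2 * l + 1) (enc_word b @ v) = enc_word b @ v"
      by (metis append_take_drop_id)
    then show "a = b" using self_delimitingD[OF self_delimiting_enc_word] by blast
  next
    assume "a = b"
    then show "same_atom x p q"
      unfolding same_atom_def
    proof (intro exI[of _ "length a"] conjI allI impI)
      show "p + 1 + 2 * length a < length x" using lp by (simp add: length_enc_word)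
      show "q + 1 + 2 * length a < length x" using lq \<open>a = b\<close> by (simp add: length_enc_word)
      show "\<not> x ! (p + 1 + 2 * length a)"
        using xp[of "2 * length a"] enc_word_nth_end[of a] by (simp add: nth_append length_enc_word)
      show "x ! (p + 1 + 2 * j)" if "j < length a" for j
        using xp[of "2 * j"] enc_word_nth[OF that] that by (simp add: nth_append length_enc_word)
      show "x ! (p + 1 + i) = x ! (q + 1 + i)" if "i \<le> 2 * length a" for i
        using xp[of i] xq[of i] that \<open>a = b\<close> by (simp add: nth_append length_enc_word)
    qed
  qed
qed

section \<open>Runs of the automaton and occurrences of literals\<close>

lemma run_on_foldl:
  assumes "run_on x L S" "p \<le> length x"
  shows "S p = foldl scan_step scan_start (take p (map (\<lambda>p. (x ! p, L p)) [0..<length x]))"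
  using assms(2)
proof (induction p)
  case 0
  then show ?case using assms(1) by (simp add: run_on_def)
next
  case (Suc p)
  then show ?case using assms(1) by (simp add: run_on_def take_Suc_conv_app_nth)
qed

lemma run_on_exists: "\<exists>S. run_on x L S"
  by (rule exI[of _ "\<lambda>p. foldl scan_step scan_start (take p (map (\<lambda>p. (x ! p, L p)) [0..<length x]))"])
    (simp add: run_on_def take_Suc_conv_app_nth)

definition phase_at :: "bool list \<Rightarrow> nat \<Rightarrow> phase" where
  "phase_at x p = foldl phase_step (Prog False) (take p x)"

lemma map_fst_labelling: "map fst (map (\<lambda>p. (x ! p, L p)) [0..<length x]) = x"
  by (simp add: o_def map_nth)

lemma fst_run_on:
  assumes "run_on x L S" "p \<le> length x"
  shows "fst (S p) = phase_at x p"
  unfolding run_on_foldl[OF assms] fst_scan take_map[symmetric] map_fst_labelling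
  by (simp add: phase_at_def scan_start_def)

text \<open>Meaningful only at the signs of an accepted word, where the literal exists and is
  unique.\<close>

definition lit_at :: "bool list \<Rightarrow> nat \<Rightarrow> atom literal" where
  "lit_at x p = (SOME l. \<exists>u. drop p x = enc_literal l @ u)"

fun complement :: "'a literal \<Rightarrow> 'a literal" where
  "complement (Pos a) = Neg a"
| "complement (Neg a) = Pos a"

lemma interpretation_lits_iff:
  "interpretation_lits I \<longleftrightarrow> (\<forall>l\<in>I. complement l \<notin> I)"
proof
  assume I: "interpretation_lits I"
  show "\<forall>l\<in>I. complement l \<notin> I"
  proof
    fix l assume "l \<in> I" then show "complement l \<notin> I"
      using I by (cases l) (auto simp: interpretation_lits_def)
  qed
next
  assume "\<forall>l\<in>I. complement l \<notin> I"
  then show "interpretation_lits I" by (fastforce simp: interpretation_lits_def)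
qed

context
  fixes x :: "bool list"
  assumes accepted: "phase_at x (length x) = Done"
begin

text \<open>Since the whole word is accepted, the rest of it is accepted from the phase at
  \<open>p\<close>, so it can be parsed on its own.\<close>

lemma drop_lit_at:
  assumes "is_sign (phase_at x p)" "p < length x"
  shows "\<exists>u. drop p x = enc_literal (lit_at x p) @ u"
proof -
  obtain b k where "phase_at x p = Sign b k" using assms by (auto simp: is_sign_def)
  moreover have "foldl phase_step (phase_at x p) (drop p x) = Done"
    using accepted by (simp add: phase_at_def flip: foldl_append)
  ultimately have "\<exists>l u. drop p x = enc_literal l @ u" using parse_literal[of b k "drop p x"] by auto
  then show ?thesis unfolding lit_at_def by (rule someI_ex)
qed

lemma lit_at_unique:
  assumes "is_sign (phase_at x p)" "p < length x" "drop p x = enc_literal l @ u"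
  shows "lit_at x p = l"
  using drop_lit_at[OF assms(1,2)] assms(3) self_delimitingD[OF self_delimiting_enc_literal] by metis

lemma same_atom_lit_at:
  assumes "is_sign (phase_at x p)" "p < length x" "is_sign (phase_at x q)" "q < length x"
  shows "same_atom x p q \<and> x ! p = x ! q \<longleftrightarrow> lit_at x p = lit_at x q"
    and "same_atom x p q \<and> x ! p \<noteq> x ! q \<longleftrightarrow> lit_at x q = complement (lit_at x p)"
proof -
  have ex: "\<exists>a u. drop r x = (x ! r) # enc_word a @ u \<and> lit_at x r = (if x ! r then Pos a else Neg a)"
    if r: "is_sign (phase_at x r)" "r < length x" for r
  proof -
    obtain u where u: "drop r x = enc_literal (lit_at x r) @ u" using drop_lit_at[OF r] by blast
    have "drop r x = x ! r # drop (Suc r) x" using r by (simp add: Cons_nth_drop_Suc)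
    with u show ?thesis by (cases "lit_at x r") auto
  qed
  obtain a u where a: "drop p x = (x ! p) # enc_word a @ u" "lit_at x p = (if x ! p then Pos a else Neg a)"
    using ex[OF assms(1,2)] by blast
  obtain b v where b: "drop q x = (x ! q) # enc_word b @ v" "lit_at x q = (if x ! q then Pos b else Neg b)"
    using ex[OF assms(3,4)] by blast
  show "same_atom x p q \<and> x ! p = x ! q \<longleftrightarrow> lit_at x p = lit_at x q"
    "same_atom x p q \<and> x ! p \<noteq> x ! q \<longleftrightarrow> lit_at x q = complement (lit_at x p)"
    unfolding same_atom_iff[OF a(1) b(1)] a(2) b(2) by auto
qed

lemma final_state:
  assumes x: "x = enc_instance p q" and S: "run_on x L S"
    and M: "\<And>r. is_sign (phase_at x r) \<Longrightarrow> r < length x \<Longrightarrow> L r = M (lit_at x r)"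
  shows "snd (snd (S (length x))) = (\<lambda>b. abstract M (if b then q else p))"
proof -
  let ?zs = "map (\<lambda>p. (x ! p, L p)) [0..<length x]"
  have "labelled M (Prog False) ?zs"
    unfolding labelled_iff map_fst_labelling
  proof (intro allI impI)
    fix r b k l u
    assume "r < length ?zs"
      and a: "foldl phase_step (Prog False) (take r x) = Sign b k \<and> drop r x = enc_literal l @ u"
    then have r: "r < length x" "is_sign (phase_at x r)" by (auto simp: phase_at_def is_sign_def)
    show "snd (?zs ! r) = M l"
      using M[OF r(2,1)] r lit_at_unique[OF r(2,1)] a by simp
  qed
  from scan_instance[OF trans[OF map_fst_labelling x] this]
  show ?thesis using run_on_foldl[OF S order.refl] by (simp add: if_distrib)
qed

end

lemma unweighted_prog_of: "unweighted (prog_of val p) = snd ` set p"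
  by (force simp: unweighted_def prog_of_def)

lemma finite_lits: "finite \<Pi> \<Longrightarrow> finite (lits \<Pi>)"
  by (auto simp: lits_def head_def pos_body_def neg_body_def)

text \<open>A word that is no instance lies in the complement, and \<open>verify\<close> is then
  vacuous since the run does not end in \<open>Done\<close>. For instances, labels that agree on
  equal literals amount to sets of literals, and one is translated into the other in both
  directions.\<close>

theorem not_in_problem_iff:
  "x \<notin> semi_uniform_equivalence_problem val \<longleftrightarrow> (\<exists>i j. \<forall>k S. verify x i j k S)"
proof (cases "phase_at x (length x) = Done")
  case False
  have "x \<noteq> enc_instance p q" for p q
    using False phase_enc_instance by (auto simp: phase_at_def)
  then have "x \<notin> semi_uniform_equivalence_problem val"
    by (auto simp: semi_uniform_equivalence_problem_def)
  moreover have "verify x i j k S" for i j k S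
    using False fst_run_on[of x _ S "length x"] by (auto simp: verify_def)
  ultimately show ?thesis by blast
next
  case acc: True
  then obtain p q where x: "x = enc_instance p q"
    using parse_instance[of x] by (auto simp: phase_at_def)
  define \<Pi> where "\<Pi> = (\<lambda>b. snd ` set (if b then q else p))"
  define U where "U = (\<Union>b. lits (\<Pi> b))"
  let ?occ = "\<lambda>r. is_sign (phase_at x r) \<and> r < length x"
  have respect: "same_atoms_respect x (\<lambda>p. fst (S p)) R \<longleftrightarrow>
      (\<forall>r r'. ?occ r \<and> ?occ r' \<and> same_atom x r r' \<longrightarrow> R r r')" if "run_on x L S" for L :: "nat \<Rightarrow> label" and S R
    unfolding same_atoms_respect_def using fst_run_on[OF that] by auto
  have same: "same_atom x r r' \<and> x ! r = x ! r'" if "?occ r" "?occ r'" "lit_at x r' = lit_at x r" for r r'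
    using same_atom_lit_at(1)[OF acc, of r r'] that by simp
  have "x \<notin> semi_uniform_equivalence_problem val \<longleftrightarrow>
      \<not> semi_uniformly_equivalent (prog_of val p) (prog_of val q)"
    unfolding x by (auto simp: semi_uniform_equivalence_problem_def enc_instance_inject)
  also have "\<dots> \<longleftrightarrow> (\<exists>I J. I \<subseteq> U \<and> (witness (\<Pi> False) (\<Pi> True) I J \<or> witness (\<Pi> True) (\<Pi> False) I J))"
    unfolding \<Pi>_def using not_semi_uniformly_equivalent_iff[of U "prog_of val p" "prog_of val q"]
    by (simp add: unweighted_prog_of U_def \<Pi>_def finite_lits UNIV_bool)
  also have "\<dots> \<longleftrightarrow> (\<exists>s I J. I \<subseteq> U \<and> witness (\<Pi> s) (\<Pi> (\<not> s)) I J)"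
    unfolding ex_bool_eq by auto
  also have "\<dots> \<longleftrightarrow> (\<exists>i j. \<forall>k S. verify x i j k S)"
  proof
    assume "\<exists>s I J. I \<subseteq> U \<and> witness (\<Pi> s) (\<Pi> (\<not> s)) I J"
    then obtain s I J where I: "I \<subseteq> U" and w: "witness (\<Pi> s) (\<Pi> (\<not> s)) I J" by blast
    \<comment> \<open>The position \<open>length x\<close> is no occurrence, so its label is free to
      hold the order of the programs.\<close>
    let ?i = "\<lambda>r. if r = length x then s else lit_at x r \<in> I"
    let ?j = "\<lambda>r. lit_at x r \<in> J"
    have "verify x ?i ?j k S" for k S
      unfolding verify_def
    proof (intro impI conjI)
      assume S: "run_on x (\<lambda>p. (?i p, ?j p, k p)) S"
      show "same_atoms_respect x (\<lambda>p. fst (S p))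
         (\<lambda>p q. if x ! p = x ! q then ?i p = ?i q \<and> ?j p = ?j q else \<not> (?i p \<and> ?i q))"
        unfolding respect[OF S]
      proof (intro allI impI)
        fix r r' assume a: "?occ r \<and> ?occ r' \<and> same_atom x r r'"
        show "if x ! r = x ! r' then ?i r = ?i r' \<and> ?j r = ?j r' else \<not> (?i r \<and> ?i r')"
          using a same_atom_lit_at[OF acc, of r r'] w
          by (auto simp: witness_def interpretation_lits_iff)
      qed
      assume k: "same_atoms_respect x (\<lambda>p. fst (S p)) (\<lambda>p q. x ! p = x ! q \<longrightarrow> k p = k q)"
      \<comment> \<open>The set \<open>K\<close> is recovered from its labels by asking for some
        marked occurrence; by assumption all occurrences of a literal agree.\<close>
      define M where "M = (\<lambda>l. (l \<in> I, l \<in> J, \<exists>r. ?occ r \<and> lit_at x r = l \<and> k r))"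
      have "snd (snd (S (length x))) = (\<lambda>b. abstract M (if b then q else p))"
      proof (rule final_state[OF acc x S])
        fix r assume r: "is_sign (phase_at x r)" "r < length x"
        have "k r = k r'" if "?occ r'" "lit_at x r' = lit_at x r" for r'
          using k[unfolded respect[OF S]] same[of r r'] r that by blast
        then have "k r \<longleftrightarrow> (\<exists>r'. ?occ r' \<and> lit_at x r' = lit_at x r \<and> k r')"
          using r by blast
        then show "(?i r, ?j r, k r) = M (lit_at x r)" using r(2) by (simp add: M_def)
      qed
      moreover have "good (\<lambda>b. abstract M (if b then q else p)) s"
      proof (subst good_iff[where I = I and J = J and K = "M -` lab\<^sub>3 \<inter> U"])
        show "I = M -` lab\<^sub>1 \<inter> (\<Union>b. lits (snd ` set (if b then q else p)))"
          using I by (auto simp: M_def U_def \<Pi>_def)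
        show "J = M -` lab\<^sub>2 \<inter> (\<Union>b. lits (snd ` set (if b then q else p)))"
          using I w by (auto simp: M_def U_def \<Pi>_def witness_def)
      qed (use w in \<open>auto simp: witness_def \<Pi>_def U_def\<close>)
      ultimately show "good (snd (snd (S (length x)))) (?i (length x))" by simp
    qed
    then show "\<exists>i j. \<forall>k S. verify x i j k S" by blast
  next
    assume "\<exists>i j. \<forall>k S. verify x i j k S"
    then obtain i j where v: "\<And>k S. verify x i j k S" by blast
    \<comment> \<open>Only the third component depends on \<open>K\<close>, so \<open>M {}\<close>
      serves to define \<open>I\<close> and \<open>J\<close>.\<close>
    define M where "M = (\<lambda>K l. (\<exists>r. ?occ r \<and> lit_at x r = l \<and> i r, \<exists>r. ?occ r \<and> lit_at x r = l \<and> j r, l \<in> K))"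
    define I where "I = M {} -` lab\<^sub>1 \<inter> U"
    define J where "J = M {} -` lab\<^sub>2 \<inter> U"
    have ij: "if x ! r = x ! r' then i r = i r' \<and> j r = j r' else \<not> (i r \<and> i r')"
      if "?occ r \<and> ?occ r' \<and> same_atom x r r'" for r r'
    proof -
      \<comment> \<open>The condition on \<open>i\<close> and \<open>j\<close> does not mention
        \<open>k\<close>, so a constant \<open>k\<close> with the run that belongs to it yields
        it.\<close>
      obtain S where S: "run_on x (\<lambda>p. (i p, j p, False)) S" using run_on_exists by blast
      show ?thesis
        using v[of "\<lambda>_. False" S] S fst_run_on[OF S, of "length x"] acc that
        unfolding verify_def respect[OF S] by auto
    qed
    have good: "good (\<lambda>b. abstract (M K) (if b then q else p)) (i (length x))" for K
    proof -
      let ?k = "\<lambda>r. lit_at x r \<in> K"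
      obtain S where S: "run_on x (\<lambda>p. (i p, j p, ?k p)) S" using run_on_exists by blast
      have "snd (snd (S (length x))) = (\<lambda>b. abstract (M K) (if b then q else p))"
      proof (rule final_state[OF acc x S])
        fix r assume r: "is_sign (phase_at x r)" "r < length x"
        have "i r = i r' \<and> j r = j r'" if "?occ r'" "lit_at x r' = lit_at x r" for r'
          using ij[of r r'] same[of r r'] r that by (simp only: if_True simp_thms)
        then have "i r \<longleftrightarrow> (\<exists>r'. ?occ r' \<and> lit_at x r' = lit_at x r \<and> i r')"
          "j r \<longleftrightarrow> (\<exists>r'. ?occ r' \<and> lit_at x r' = lit_at x r \<and> j r')"
          using r by blast+
        then show "(i r, j r, ?k r) = M K (lit_at x r)" by (simp only: M_def)
      qed
      moreover have "same_atoms_respect x (\<lambda>p. fst (S p)) (\<lambda>p q. x ! p = x ! q \<longrightarrow> ?k p = ?k q)"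
        unfolding respect[OF S] using same_atom_lit_at(1)[OF acc] by metis
      ultimately show ?thesis
        using v[of ?k S] S fst_run_on[OF S, of "length x"] acc unfolding verify_def by auto
    qed
    have iff: "J \<subset> I \<and> red_sat (\<Pi> (\<not> i (length x))) I J \<and>
        (J \<subseteq> K \<and> K \<subset> I \<longrightarrow> \<not> red_sat (\<Pi> (i (length x))) I K)" if "K \<subseteq> U" for K
    proof -
      let ?U = "\<Union>b. lits (snd ` set (if b then q else p))"
      have IJK: "I = M K -` lab\<^sub>1 \<inter> ?U" "J = M K -` lab\<^sub>2 \<inter> ?U" "K = M K -` lab\<^sub>3 \<inter> ?U"
        using that unfolding I_def J_def U_def \<Pi>_def M_def vimage_def by (simp, simp, auto)
      from good[of K] show ?thesis unfolding good_iff[OF IJK] \<Pi>_def .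
    qed
    have "interpretation_lits I"
      unfolding interpretation_lits_iff
    proof (intro ballI notI)
      fix l assume "l \<in> I" "complement l \<in> I"
      then obtain r r' where "?occ r" "lit_at x r = l" "i r" "?occ r'" "lit_at x r' = complement l" "i r'"
        by (auto simp: I_def M_def)
      then have "same_atom x r r' \<and> x ! r \<noteq> x ! r'"
        using same_atom_lit_at(2)[OF acc, of r r'] by simp
      with ij[of r r'] \<open>?occ r\<close> \<open>?occ r'\<close> \<open>i r\<close> \<open>i r'\<close> show False by simp
    qed
    have "I \<subseteq> U" by (simp add: I_def)
    have "\<not> red_sat (\<Pi> (i (length x))) I K" if "J \<subseteq> K \<and> K \<subset> I" for K
      using iff[of K] that \<open>I \<subseteq> U\<close> by (meson order.trans psubset_imp_subset)
    \<comment> \<open>The instance \<open>{}\<close> supplies the clauses that do not depend on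
      \<open>K\<close>.\<close>
    with \<open>interpretation_lits I\<close> iff[of "{}"]
    have "witness (\<Pi> (i (length x))) (\<Pi> (\<not> i (length x))) I J"
      unfolding witness_def by simp
    with \<open>I \<subseteq> U\<close> show "\<exists>s I J. I \<subseteq> U \<and> witness (\<Pi> s) (\<Pi> (\<not> s)) I J" by blast
  qed
  finally show ?thesis .
qed


section \<open>The check is first-order definable\<close>

definition FAll :: "nat \<Rightarrow> fm \<Rightarrow> fm" where "FAll v \<phi> = FNot (FEx v (FNot \<phi>))"
definition FImp :: "fm \<Rightarrow> fm \<Rightarrow> fm" where "FImp \<phi> \<psi> = FNot (FAnd \<phi> (FNot \<psi>))"

text \<open>An arbitrary Boolean function of finitely many truth values. It lets the decoding of
  blocks, \<open>scan_step\<close> and \<open>good\<close> enter a formula as finite tables.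
  \<open>FLin [] [] 1\<close> is the false formula \<open>1 = 0\<close>.\<close>

primrec FTable :: "fm list \<Rightarrow> (bool list \<Rightarrow> bool) \<Rightarrow> fm" where
  "FTable [] f = (if f [] then FLin [] [] 0 else FLin [] [] 1)"
| "FTable (\<phi> # \<phi>s) f = FAnd (FImp \<phi> (FTable \<phi>s (\<lambda>bs. f (True # bs))))
     (FImp (FNot \<phi>) (FTable \<phi>s (\<lambda>bs. f (False # bs))))"

lemma FAll_simps [simp]:
  "sat w e (FAll v \<phi>) \<longleftrightarrow> (\<forall>a \<le> Suc (length w). sat w (e(v := a)) \<phi>)"
  "bvars (FAll v \<phi>) = insert v (bvars \<phi>)" "wf_fm (FAll v \<phi>) \<longleftrightarrow> wf_fm \<phi> \<and> v \<notin> bvars \<phi>"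
  by (simp_all add: FAll_def)

lemma FImp_simps [simp]:
  "sat w e (FImp \<phi> \<psi>) \<longleftrightarrow> (sat w e \<phi> \<longrightarrow> sat w e \<psi>)"
  "bvars (FImp \<phi> \<psi>) = bvars \<phi> \<union> bvars \<psi>" "wf_fm (FImp \<phi> \<psi>) \<longleftrightarrow> wf_fm \<phi> \<and> wf_fm \<psi>"
  by (auto simp: FImp_def)

lemma sat_FTable [simp]: "sat w e (FTable \<phi>s f) \<longleftrightarrow> f (map (sat w e) \<phi>s)"
  by (induction \<phi>s arbitrary: f) (simp_all, metis)

lemma bvars_FTable [simp]: "bvars (FTable \<phi>s f) = (\<Union>\<phi>\<in>set \<phi>s. bvars \<phi>)"
  by (induction \<phi>s arbitrary: f) simp_all

lemma wf_FTable [simp]: "wf_fm (FTable \<phi>s f) \<longleftrightarrow> (\<forall>\<phi>\<in>set \<phi>s. wf_fm \<phi>)"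
  by (induction \<phi>s arbitrary: f) auto

declare FTable.simps [simp del]

section \<open>Positions in an encoded triple\<close>

lemma length_enc_triple: "length (enc_triple x y z) = 2 * length x + 2 * length y + 2 * length z + 3"
  by (simp add: enc_triple_def length_enc_word)

lemma enc_triple_nth:
  shows "i < length x \<Longrightarrow> enc_triple x y z ! (2 * i + 1) = x ! i"
    and "i < length y \<Longrightarrow> enc_triple x y z ! (2 * length x + 1 + (2 * i + 1)) = y ! i"
    and "i < length z \<Longrightarrow> enc_triple x y z ! (2 * length x + 1 + (2 * length y + 1 + (2 * i + 1))) = z ! i"
    and "i \<le> length x \<Longrightarrow> enc_triple x y z ! (2 * i) \<longleftrightarrow> i < length x"
    and "i \<le> length y \<Longrightarrow> enc_triple x y z ! (2 * length x + 1 + 2 * i) \<longleftrightarrow> i < length y"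
proof -
  note len = length_enc_word
  have w: "enc_triple x y z ! m = (enc_word x @ (enc_word y @ enc_word z)) ! m" for m
    by (simp add: enc_triple_def)
  have x: "enc_triple x y z ! m = enc_word x ! m" if "m < 2 * length x + 1" for m
    using that unfolding w by (simp add: nth_append len)
  have yz: "enc_triple x y z ! (2 * length x + 1 + m) = (enc_word y @ enc_word z) ! m" for m
    unfolding w len[symmetric] by (simp only: nth_append_length_plus)
  then have y: "enc_triple x y z ! (2 * length x + 1 + m) = enc_word y ! m" if "m < 2 * length y + 1" for m
    using that by (simp add: nth_append len)
  have z: "enc_triple x y z ! (2 * length x + 1 + (2 * length y + 1 + m)) = enc_word z ! m" for m
    unfolding yz unfolding len[symmetric] by (simp only: nth_append_length_plus)
  show "i < length x \<Longrightarrow> enc_triple x y z ! (2 * i + 1) = x ! i"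
    by (subst x) (simp_all add: enc_word_nth_bit[simplified])
  show "i < length y \<Longrightarrow> enc_triple x y z ! (2 * length x + 1 + (2 * i + 1)) = y ! i"
    by (subst y) (simp_all add: enc_word_nth_bit[simplified])
  show "i < length z \<Longrightarrow> enc_triple x y z ! (2 * length x + 1 + (2 * length y + 1 + (2 * i + 1))) = z ! i"
    unfolding z by (rule enc_word_nth_bit)
  have marker: "enc_word u ! (2 * i) \<longleftrightarrow> i < length u" if "i \<le> length u" for u
    using that enc_word_nth[of i u] enc_word_nth_end[of u] by (cases "i = length u") auto
  show "i \<le> length x \<Longrightarrow> enc_triple x y z ! (2 * i) \<longleftrightarrow> i < length x"
    by (subst x) (simp_all add: marker)
  show "i \<le> length y \<Longrightarrow> enc_triple x y z ! (2 * length x + 1 + 2 * i) \<longleftrightarrow> i < length y"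
    by (subst y) (simp_all add: marker)
qed

text \<open>\<open>False\<close> beyond the end, so that words of any length can be read as
  labels.\<close>

definition bit :: "bool list \<Rightarrow> nat \<Rightarrow> bool" where
  "bit x m \<longleftrightarrow> m < length x \<and> x ! m"

text \<open>
  In the following formulas on \<open>enc_triple x y z\<close>, the variables \<open>0\<close> and \<open>1\<close> denote the positions
  where the codes of \<open>x\<close> and \<open>y\<close> end, and \<open>6\<close> and \<open>7\<close> are used for auxiliary quantifiers.
\<close>

definition fm_less :: "nat \<Rightarrow> nat \<Rightarrow> fm" where
  "fm_less a b = FEx 6 (FLin [6, a] [b] 1)"

text \<open>The code starts after as many letters as the variables in \<open>as\<close> sum up to.
  Its markers stand at odd distances from there, and \<open>b\<close> is the first of them that is
  \<open>False\<close>.\<close>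

definition fm_end :: "nat list \<Rightarrow> nat \<Rightarrow> fm" where
  "fm_end as b = FAnd (FEx 4 (FLin (4 # 4 # as) [b] 1)) (FAnd (FNot (FBit b))
     (FAll 5 (FAll 7 (FImp (FAnd (FLin (5 # 5 # as) [7] 1) (fm_less 7 b)) (FBit 7)))))"

text \<open>The letter of \<open>x\<close> with index \<open>m\<close> is at position
  \<open>2 * m + 2\<close>, whence the doubled list \<open>ts\<close> and the constant; variable 6
  is the slack.\<close>

definition x_less :: "nat list \<Rightarrow> nat \<Rightarrow> fm" where
  "x_less ts c = FEx 6 (FLin (6 # ts @ ts) [0] (2 * c + 2))"

definition x_bit :: "nat list \<Rightarrow> nat \<Rightarrow> fm" where
  "x_bit ts c = FEx 7 (FAnd (FLin (ts @ ts) [7] (2 * c + 2)) (FAnd (fm_less 7 0) (FBit 7)))"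

text \<open>The two labels of each position are interleaved in \<open>y\<close>. The factor 4 is one
  2 for the interleaving and one for the markers in the code of \<open>y\<close>.\<close>

definition y_bit :: "nat \<Rightarrow> nat \<Rightarrow> fm" where
  "y_bit p t = FEx 7 (FAnd (FLin (0 # replicate 4 p) [7] (2 * t + 2)) (FAnd (fm_less 7 1) (FBit 7)))"

definition z_bit :: "nat \<Rightarrow> nat \<Rightarrow> nat \<Rightarrow> fm" where
  "z_bit c p t = FEx 7 (FAnd (FLin (1 # replicate (2 * c) p) [7] (2 * t + 2)) (FBit 7))"

lemma fm_macros_wf [simp]:
  "wf_fm (fm_less a b)" "bvars (fm_less a b) = {6}"
  "wf_fm (fm_end as b)" "bvars (fm_end as b) = {4, 5, 6, 7}"
  "wf_fm (x_less ts c)" "bvars (x_less ts c) = {6}"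
  "wf_fm (x_bit ts c)" "bvars (x_bit ts c) = {6, 7}"
  "wf_fm (y_bit p t)" "bvars (y_bit p t) = {6, 7}"
  "wf_fm (z_bit c p t)" "bvars (z_bit c p t) = {7}"
  by (auto simp: fm_less_def fm_end_def x_less_def x_bit_def y_bit_def z_bit_def)

lemma sat_fm_less:
  "a \<noteq> 6 \<Longrightarrow> b \<noteq> 6 \<Longrightarrow> e b \<le> Suc (length w) \<Longrightarrow> sat w e (fm_less a b) \<longleftrightarrow> e a < e b"
  unfolding fm_less_def by (auto simp: less_iff_Suc_add intro!: exI[of _ "e b - Suc (e a)"])

lemma sat_fm_end:
  assumes as: "set as \<inter> {4, 5, 6, 7} = {}" and b: "b \<notin> {4, 5, 6, 7}" "e b \<le> Suc (length w)"
    and L: "sum_list (map e as) + 2 * L < length w"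
    and marker: "\<And>h. h \<le> L \<Longrightarrow> w ! (sum_list (map e as) + 2 * h) \<longleftrightarrow> h < L"
  shows "sat w e (fm_end as b) \<longleftrightarrow> e b = sum_list (map e as) + 2 * L + 1"
proof -
  let ?a = "sum_list (map e as)"
  have upd: "map (e(v := h)) as = map e as" if "v \<in> {4, 5, 6, 7}" for v h
    using that as by (intro map_cong) auto
  have upd2: "map (e(5 := h, 7 := v)) as = map e as" for h v
    using as by (intro map_cong) auto
  have less: "sat w (e(5 := h, 7 := v)) (fm_less 7 b) \<longleftrightarrow> v < e b" for h v
    using sat_fm_less[of 7 b "e(5 := h, 7 := v)" w] b by simp
  have eq: "Suc (h + (h + A)) = B \<longleftrightarrow> B = A + 2 * h + 1" for h A B :: nat by arith
  have "sat w e (fm_end as b) \<longleftrightarrow> (\<exists>h \<le> Suc (length w). e b = ?a + 2 * h + 1) \<and>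
      \<not> (1 \<le> e b \<and> e b \<le> length w \<and> w ! (e b - 1)) \<and>
      (\<forall>h \<le> Suc (length w). \<forall>v \<le> Suc (length w). v = ?a + 2 * h + 1 \<and> v < e b \<longrightarrow>
        1 \<le> v \<and> v \<le> length w \<and> w ! (v - 1))"
    using b by (simp add: fm_end_def upd upd2 less eq)
  also have "\<dots> \<longleftrightarrow> e b = ?a + 2 * L + 1"
  proof
    assume a: "(\<exists>h \<le> Suc (length w). e b = ?a + 2 * h + 1) \<and>
      \<not> (1 \<le> e b \<and> e b \<le> length w \<and> w ! (e b - 1)) \<and>
      (\<forall>h \<le> Suc (length w). \<forall>v \<le> Suc (length w). v = ?a + 2 * h + 1 \<and> v < e b \<longrightarrow>
        1 \<le> v \<and> v \<le> length w \<and> w ! (v - 1))"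
    then obtain h where h: "e b = ?a + 2 * h + 1" by blast
    have "\<not> h < L"
    proof
      assume "h < L"
      with marker[of h] L a h show False by simp
    qed
    moreover have "\<not> L < h"
    proof
      assume "L < h"
      then have "?a + 2 * L + 1 < e b" using h by simp
      moreover have "?a + 2 * L + 1 \<le> Suc (length w)" "L \<le> Suc (length w)" using L by simp_all
      ultimately have "w ! (?a + 2 * L + 1 - 1)" using a by blast
      with marker[of L] show False by simp
    qed
    ultimately show "e b = ?a + 2 * L + 1" using h by simp
  next
    assume eb: "e b = ?a + 2 * L + 1"
    have "\<exists>h \<le> Suc (length w). e b = ?a + 2 * h + 1" using eb L by (intro exI[of _ L]) simp
    moreover have "\<not> w ! (e b - 1)" using marker[of L] eb by simp
    moreover have "w ! (v - 1) \<and> 1 \<le> v \<and> v \<le> length w" if "v = ?a + 2 * h + 1" "v < e b" for h v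
      using marker[of h] that eb L by simp
    ultimately show "(\<exists>h \<le> Suc (length w). e b = ?a + 2 * h + 1) \<and>
      \<not> (1 \<le> e b \<and> e b \<le> length w \<and> w ! (e b - 1)) \<and>
      (\<forall>h \<le> Suc (length w). \<forall>v \<le> Suc (length w). v = ?a + 2 * h + 1 \<and> v < e b \<longrightarrow>
        1 \<le> v \<and> v \<le> length w \<and> w ! (v - 1))" by blast
  qed
  finally show ?thesis .
qed

text \<open>Variables 2 and 3 are the two signs, 4 is the length \<open>l\<close>, and 5 is first
  \<open>j\<close> and then \<open>d\<close>; variable 6 in the last clause is the slack in
  \<open>d \<le> 2 * l\<close>.\<close>

definition fm_same_atom :: fm where
  "fm_same_atom = FEx 4 (FAnd (x_less [2, 4, 4] 1) (FAnd (x_less [3, 4, 4] 1)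
     (FAnd (FNot (x_bit [2, 4, 4] 1)) (FAnd
       (FAll 5 (FImp (fm_less 5 4) (x_bit [2, 5, 5] 1)))
       (FAll 5 (FImp (FEx 6 (FLin [6, 5] [4, 4] 0))
         (FTable [x_bit [2, 5] 1, x_bit [3, 5] 1] (\<lambda>bs. bs ! 0 = bs ! 1))))))))"

definition z_block :: "nat \<Rightarrow> nat \<Rightarrow> fm list" where
  "z_block c p = map (z_bit c p) [0..<c]"

definition fm_respect :: "nat \<Rightarrow> (bool list \<Rightarrow> bool \<times> phase \<times> label memory) \<Rightarrow> fm \<Rightarrow> fm" where
  "fm_respect c dec R = FAll 2 (FImp (x_less [2] 0) (FAll 3 (FImp (x_less [3] 0)
     (FImp (FTable (z_block c 2) (\<lambda>bs. is_sign (fst (snd (dec bs)))))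
     (FImp (FTable (z_block c 3) (\<lambda>bs. is_sign (fst (snd (dec bs)))))
     (FImp fm_same_atom R))))))"

text \<open>The linear equation forces variable 2 to be \<open>length x\<close>, where
  \<open>y_bit 2 0\<close> is the choice of the order.\<close>

definition fm_final ::
  "nat \<Rightarrow> (bool list \<Rightarrow> bool \<times> phase \<times> label memory) \<Rightarrow> (bool \<Rightarrow> phase \<times> label memory \<Rightarrow> bool) \<Rightarrow> fm"
  where
  "fm_final c dec f = FAll 2 (FImp (FLin [2, 2] [0] 1)
     (FTable (y_bit 2 0 # z_block c 2) (\<lambda>bs. f (hd bs) (snd (dec (tl bs))))))"

text \<open>After the three bits of input and labels come \<open>c\<close> bits for the block at
  \<open>p\<close> and \<open>c\<close> bits for the block at \<open>p + 1\<close>.\<close>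

definition fm_run :: "nat \<Rightarrow> (bool list \<Rightarrow> bool \<times> phase \<times> label memory) \<Rightarrow> fm" where
  "fm_run c dec = FAnd
     (FAll 2 (FImp (FLin [2] [] 0) (FTable (z_block c 2) (\<lambda>bs. snd (dec bs) = scan_start))))
     (FAll 2 (FImp (x_less [2] 0)
       (FTable (x_bit [2] 0 # y_bit 2 0 # y_bit 2 1 # z_block c 2 @ map (\<lambda>t. z_bit c 2 (c + t)) [0..<c])
         (\<lambda>bs. snd (dec (drop c (drop 3 bs))) =
            scan_step (snd (dec (take c (drop 3 bs))))
              (bs ! 0, bs ! 1, bs ! 2, fst (dec (take c (drop 3 bs))))))))"

definition fm_verify :: "nat \<Rightarrow> (bool list \<Rightarrow> bool \<times> phase \<times> label memory) \<Rightarrow> fm" where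
  "fm_verify c dec = FImp (fm_run c dec) (FImp (fm_final c dec (\<lambda>_ s. fst s = Done)) (FAnd
     (fm_respect c dec (FTable [x_bit [2] 0, x_bit [3] 0, y_bit 2 0, y_bit 3 0, y_bit 2 1, y_bit 3 1]
       (\<lambda>bs. if bs ! 0 = bs ! 1 then bs ! 2 = bs ! 3 \<and> bs ! 4 = bs ! 5 else \<not> (bs ! 2 \<and> bs ! 3))))
     (FImp
       (fm_respect c dec (FTable (x_bit [2] 0 # x_bit [3] 0 # z_block c 2 @ z_block c 3)
         (\<lambda>bs. bs ! 0 = bs ! 1 \<longrightarrow>
           fst (dec (take c (drop 2 bs))) = fst (dec (drop c (drop 2 bs))))))
       (fm_final c dec (\<lambda>b s. good (snd (snd s)) b)))))"

definition fm_problem :: "nat \<Rightarrow> (bool list \<Rightarrow> bool \<times> phase \<times> label memory) \<Rightarrow> fm" where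
  "fm_problem c dec = FEx 0 (FEx 1 (FAnd (fm_end [] 0) (FAnd (fm_end [0] 1) (fm_verify c dec))))"

lemma wf_fm_problem: "wf_fm (fm_problem c dec)"
  by (auto simp: fm_problem_def fm_verify_def fm_run_def fm_final_def fm_respect_def
      fm_same_atom_def z_block_def)

section \<open>Meaning of the formulas on encoded triples\<close>

locale triple_formulas =
  fixes x y z :: "bool list" and c :: nat
begin

definition w :: "bool list" where "w = enc_triple x y z"

definition frame :: "(nat \<Rightarrow> nat) \<Rightarrow> bool" where
  "frame e \<longleftrightarrow> e 0 = 2 * length x + 1 \<and> e 1 = 2 * length x + 2 * length y + 2"

lemma frame_upd [simp]: "v \<noteq> 0 \<Longrightarrow> v \<noteq> 1 \<Longrightarrow> frame (e(v := a)) \<longleftrightarrow> frame e"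
  by (simp add: frame_def)

lemma length_w: "length w = 2 * length x + 2 * length y + 2 * length z + 3"
  by (simp add: w_def length_enc_triple)

lemma sat_x_less:
  assumes "frame e" "6 \<notin> set ts"
  shows "sat w e (x_less ts d) \<longleftrightarrow> sum_list (map e ts) + d < length x"
proof -
  have upd: "map (e(6 := a)) ts = map e ts" for a
    using assms by (intro map_cong) auto
  have "sat w e (x_less ts d) \<longleftrightarrow>
      (\<exists>a \<le> Suc (length w). a + 2 * sum_list (map e ts) + (2 * d + 2) = 2 * length x + 1)"
    using assms by (simp add: x_less_def upd frame_def algebra_simps)
  also have "\<dots> \<longleftrightarrow> sum_list (map e ts) + d < length x"
    by (auto simp: length_w intro!: exI[of _ "2 * length x + 1 - (2 * sum_list (map e ts) + (2 * d + 2))"])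
  finally show ?thesis .
qed

lemma sat_x_bit:
  assumes "frame e" "set ts \<inter> {6, 7} = {}"
  shows "sat w e (x_bit ts d) \<longleftrightarrow> bit x (sum_list (map e ts) + d)"
proof -
  let ?m = "sum_list (map e ts) + d"
  have upd: "map (e(7 := a)) ts = map e ts" for a
    using assms by (intro map_cong) auto
  have less: "sat w (e(7 := a)) (fm_less 7 0) \<longleftrightarrow> a < 2 * length x + 1" for a
    using sat_fm_less[of 7 0 "e(7 := a)" w] assms by (simp add: frame_def length_w)
  have "sat w e (x_bit ts d) \<longleftrightarrow> (\<exists>a \<le> Suc (length w). a = 2 * ?m + 2 \<and> a < 2 * length x + 1 \<and>
      1 \<le> a \<and> a \<le> length w \<and> w ! (a - 1))"
    by (simp add: x_bit_def upd less algebra_simps)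
  also have "\<dots> \<longleftrightarrow> ?m < length x \<and> w ! (2 * ?m + 1)"
    by (auto simp: length_w)
  also have "\<dots> \<longleftrightarrow> bit x ?m"
    using enc_triple_nth(1)[of ?m x y z] by (auto simp: bit_def w_def)
  finally show ?thesis .
qed

lemma sat_y_bit:
  assumes "frame e" "p \<notin> {6, 7}"
  shows "sat w e (y_bit p t) \<longleftrightarrow> bit y (2 * e p + t)"
proof -
  let ?m = "2 * e p + t"
  have less: "sat w (e(7 := a)) (fm_less 7 1) \<longleftrightarrow> a < 2 * length x + 2 * length y + 2" for a
    using sat_fm_less[of 7 1 "e(7 := a)" w] assms by (simp add: frame_def length_w)
  have "sat w e (y_bit p t) \<longleftrightarrow> (\<exists>a \<le> Suc (length w). a = 2 * length x + 1 + (2 * ?m + 1) + 1 \<and>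
      a < 2 * length x + 2 * length y + 2 \<and> 1 \<le> a \<and> a \<le> length w \<and> w ! (a - 1))"
    using assms
    by (simp add: y_bit_def less[unfolded One_nat_def] frame_def sum_list_replicate) (auto simp: algebra_simps)
  also have "\<dots> \<longleftrightarrow> ?m < length y \<and> w ! (2 * length x + 1 + (2 * ?m + 1))"
    by (auto simp: length_w)
  also have "\<dots> \<longleftrightarrow> bit y ?m"
    using enc_triple_nth(2)[of ?m y x z] by (auto simp: bit_def w_def)
  finally show ?thesis .
qed

lemma sat_z_bit:
  assumes "frame e" "p \<noteq> 7"
  shows "sat w e (z_bit c p t) \<longleftrightarrow> bit z (c * e p + t)"
proof -
  let ?m = "c * e p + t"
  have "sat w e (z_bit c p t) \<longleftrightarrow> (\<exists>a \<le> Suc (length w).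
      a = 2 * length x + 1 + (2 * length y + 1 + (2 * ?m + 1)) + 1 \<and>
      1 \<le> a \<and> a \<le> length w \<and> w ! (a - 1))"
    using assms
    by (simp add: z_bit_def frame_def sum_list_replicate) (auto simp: algebra_simps)
  also have "\<dots> \<longleftrightarrow> ?m < length z \<and> w ! (2 * length x + 1 + (2 * length y + 1 + (2 * ?m + 1)))"
    by (auto simp: length_w)
  also have "\<dots> \<longleftrightarrow> bit z ?m"
    using enc_triple_nth(3)[of ?m z x y] by (auto simp: bit_def w_def)
  finally show ?thesis .
qed

lemma sat_fm_same_atom:
  assumes "frame e" "e 2 < length x" "e 3 < length x"
  shows "sat w e fm_same_atom \<longleftrightarrow> same_atom x (e 2) (e 3)"
proof -
  let ?p = "e 2" and ?q = "e 3"
  have len: "length x \<le> length w" by (simp add: length_w)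
  \<comment> \<open>Quantifiers range over positions only; this loses nothing, as the slack is at
    most \<open>2 * l\<close>, which is below \<open>length x\<close>.\<close>
  have ex: "(\<exists>a \<le> Suc (length w). a + d = l + l) \<longleftrightarrow> d \<le> 2 * l" if "?p + (l + l) + 1 < length x" for d l
    using that len by (auto intro!: exI[of _ "2 * l - d"])
  have "sat w e fm_same_atom \<longleftrightarrow> (\<exists>l \<le> Suc (length w). ?p + (l + l) + 1 < length x \<and>
      ?q + (l + l) + 1 < length x \<and> \<not> bit x (?p + (l + l) + 1) \<and>
      (\<forall>j \<le> Suc (length w). j < l \<longrightarrow> bit x (?p + (j + j) + 1)) \<and>
      (\<forall>d \<le> Suc (length w). (\<exists>a \<le> Suc (length w). a + d = l + l) \<longrightarrow>
        bit x (?p + d + 1) = bit x (?q + d + 1)))"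
    using assms(1) by (simp add: fm_same_atom_def sat_x_less sat_x_bit sat_fm_less add.assoc cong: conj_cong)
  also have "\<dots> \<longleftrightarrow> same_atom x ?p ?q"
    unfolding same_atom_def
  proof (rule iff_exI, rule iffI)
    fix l
    assume a: "l \<le> Suc (length w) \<and> ?p + (l + l) + 1 < length x \<and>
      ?q + (l + l) + 1 < length x \<and> \<not> bit x (?p + (l + l) + 1) \<and>
      (\<forall>j \<le> Suc (length w). j < l \<longrightarrow> bit x (?p + (j + j) + 1)) \<and>
      (\<forall>d \<le> Suc (length w). (\<exists>a \<le> Suc (length w). a + d = l + l) \<longrightarrow>
        bit x (?p + d + 1) = bit x (?q + d + 1))"
    have "bit x (?p + (j + j) + 1)" if "j < l" for j
      using a that by simp
    moreover have "bit x (?p + d + 1) = bit x (?q + d + 1)" if "d \<le> 2 * l" for d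
      using a ex[of l d] that len by simp
    ultimately show "?p + 1 + 2 * l < length x \<and> ?q + 1 + 2 * l < length x \<and>
        \<not> x ! (?p + 1 + 2 * l) \<and> (\<forall>j<l. x ! (?p + 1 + 2 * j)) \<and>
        (\<forall>d \<le> 2 * l. x ! (?p + 1 + d) = x ! (?q + 1 + d))"
      using a by (simp add: bit_def mult_2)
  next
    fix l
    assume a: "?p + 1 + 2 * l < length x \<and> ?q + 1 + 2 * l < length x \<and>
        \<not> x ! (?p + 1 + 2 * l) \<and> (\<forall>j<l. x ! (?p + 1 + 2 * j)) \<and>
        (\<forall>d \<le> 2 * l. x ! (?p + 1 + d) = x ! (?q + 1 + d))"
    then have l: "?p + (l + l) + 1 < length x" by simp
    have "bit x (?p + (j + j) + 1)" if "j < l" for j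
    proof -
      have "x ! (?p + 1 + 2 * j)" using a that by blast
      then show ?thesis using l that by (simp add: bit_def mult_2)
    qed
    moreover have "bit x (?p + d + 1) = bit x (?q + d + 1)" if "d \<le> 2 * l" for d
    proof -
      have "x ! (?p + 1 + d) = x ! (?q + 1 + d)" using a that by blast
      then show ?thesis using a that by (simp add: bit_def)
    qed
    ultimately show "l \<le> Suc (length w) \<and> ?p + (l + l) + 1 < length x \<and>
      ?q + (l + l) + 1 < length x \<and> \<not> bit x (?p + (l + l) + 1) \<and>
      (\<forall>j \<le> Suc (length w). j < l \<longrightarrow> bit x (?p + (j + j) + 1)) \<and>
      (\<forall>d \<le> Suc (length w). (\<exists>a \<le> Suc (length w). a + d = l + l) \<longrightarrow>
        bit x (?p + d + 1) = bit x (?q + d + 1))"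
      using a l len ex[OF l] by (simp add: bit_def mult_2)
  qed
  finally show ?thesis .
qed

definition block :: "nat \<Rightarrow> bool list" where
  "block p = map (\<lambda>t. bit z (c * p + t)) [0..<c]"

lemma sat_z_block: "frame e \<Longrightarrow> p \<noteq> 7 \<Longrightarrow> map (sat w e) (z_block c p) = block (e p)"
  by (simp add: z_block_def block_def sat_z_bit)

lemma sat_z_block_Suc:
  "frame e \<Longrightarrow> p \<noteq> 7 \<Longrightarrow> map (sat w e) (map (\<lambda>t. z_bit c p (c + t)) [0..<c]) = block (Suc (e p))"
  by (simp add: block_def sat_z_bit add_ac)

lemma length_block [simp]: "length (block p) = c"
  by (simp add: block_def)

lemma sat_fm_respect:
  assumes "frame e"
  shows "sat w e (fm_respect c dec R) \<longleftrightarrow> same_atoms_respect x (\<lambda>p. fst (snd (dec (block p))))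
    (\<lambda>p q. sat w (e(2 := p, 3 := q)) R)"
proof -
  have "length x \<le> length w" by (simp add: length_w)
  have "sat w e (fm_respect c dec R) \<longleftrightarrow> (\<forall>p \<le> Suc (length w). p < length x \<longrightarrow>
      (\<forall>q \<le> Suc (length w). q < length x \<longrightarrow> is_sign (fst (snd (dec (block p)))) \<longrightarrow>
        is_sign (fst (snd (dec (block q)))) \<longrightarrow> same_atom x p q \<longrightarrow> sat w (e(2 := p, 3 := q)) R))"
    using assms by (simp add: fm_respect_def sat_x_less sat_z_block sat_fm_same_atom cong: imp_cong)
  then show ?thesis
    using \<open>length x \<le> length w\<close> unfolding same_atoms_respect_def
    by (meson le_SucI less_imp_le order.trans)
qed

lemma sat_fm_final:
  assumes "frame e"
  shows "sat w e (fm_final c dec f) \<longleftrightarrow> f (bit y (2 * length x)) (snd (dec (block (length x))))"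
proof -
  have eq: "Suc (p + p) = Suc (2 * length x) \<longleftrightarrow> p = length x" for p by arith
  have "length x \<le> Suc (length w)" by (simp add: length_w)
  moreover have "sat w e (fm_final c dec f) \<longleftrightarrow> (\<forall>p \<le> Suc (length w). p = length x \<longrightarrow>
      f (bit y (2 * p)) (snd (dec (block p))))"
    using assms frame_def[of e] eq
    by (simp add: fm_final_def sat_y_bit sat_z_block)
  ultimately show ?thesis by simp
qed

lemma sat_fm_run:
  assumes "frame e"
  shows "sat w e (fm_run c dec) \<longleftrightarrow>
    run_on x (\<lambda>p. (bit y (2 * p), bit y (2 * p + 1), fst (dec (block p)))) (\<lambda>p. snd (dec (block p)))"
proof -
  have drop: "drop 3 (a # b # d # bs) = bs" "drop (c + 3) (a # b # d # bs) = drop c bs"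
    and nth: "(a # b # d # bs) ! 2 = d" for a b d :: bool and bs
    by (simp_all add: numeral_3_eq_3 numeral_2_eq_2)
  have "length x \<le> length w" by (simp add: length_w)
  have "sat w e (fm_run c dec) \<longleftrightarrow> snd (dec (block 0)) = scan_start \<and>
      (\<forall>p \<le> Suc (length w). p < length x \<longrightarrow> snd (dec (block (Suc p))) =
        scan_step (snd (dec (block p))) (bit x p, bit y (2 * p), bit y (2 * p + 1), fst (dec (block p))))"
    using assms
    by (simp add: fm_run_def sat_x_less sat_x_bit sat_y_bit sat_z_block sat_z_block_Suc[simplified]
        drop nth)
  moreover have "bit x p = x ! p" if "p < length x" for p
    using that by (simp add: bit_def)
  ultimately show ?thesis
    using \<open>length x \<le> length w\<close> unfolding run_on_def by auto
qed

lemma sat_fm_verify: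
  assumes "frame e"
  shows "sat w e (fm_verify c dec) \<longleftrightarrow> verify x (\<lambda>p. bit y (2 * p)) (\<lambda>p. bit y (2 * p + 1))
    (\<lambda>p. fst (dec (block p))) (\<lambda>p. snd (dec (block p)))"
proof -
  have cong: "same_atoms_respect x ph R \<longleftrightarrow> same_atoms_respect x ph R'"
    if "\<And>p q. p < length x \<Longrightarrow> q < length x \<Longrightarrow> R p q \<longleftrightarrow> R' p q" for ph R R'
    using that by (simp add: same_atoms_respect_def)
  have xbit: "bit x p = x ! p" if "p < length x" for p
    using that by (simp add: bit_def)
  have 1: "sat w e (fm_respect c dec (FTable [x_bit [2] 0, x_bit [3] 0, y_bit 2 0, y_bit 3 0, y_bit 2 1, y_bit 3 1]
       (\<lambda>bs. if bs ! 0 = bs ! 1 then bs ! 2 = bs ! 3 \<and> bs ! 4 = bs ! 5 else \<not> (bs ! 2 \<and> bs ! 3)))) \<longleftrightarrow>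
    same_atoms_respect x (\<lambda>p. fst (snd (dec (block p))))
     (\<lambda>p q. if x ! p = x ! q then bit y (2 * p) = bit y (2 * q) \<and> bit y (2 * p + 1) = bit y (2 * q + 1)
       else \<not> (bit y (2 * p) \<and> bit y (2 * q)))"
    unfolding sat_fm_respect[OF assms]
    by (rule cong) (use assms in \<open>simp add: sat_x_bit sat_y_bit xbit\<close>)
  have 2: "sat w e (fm_respect c dec (FTable (x_bit [2] 0 # x_bit [3] 0 # z_block c 2 @ z_block c 3)
       (\<lambda>bs. bs ! 0 = bs ! 1 \<longrightarrow>
           fst (dec (take c (drop 2 bs))) = fst (dec (drop c (drop 2 bs)))))) \<longleftrightarrow>
    same_atoms_respect x (\<lambda>p. fst (snd (dec (block p))))
     (\<lambda>p q. x ! p = x ! q \<longrightarrow> fst (dec (block p)) = fst (dec (block q)))"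
    unfolding sat_fm_respect[OF assms]
    by (rule cong) (use assms in \<open>simp add: sat_x_bit sat_z_block xbit numeral_2_eq_2\<close>)
  show ?thesis
    unfolding fm_verify_def FImp_simps sat.simps(4) sat_fm_run[OF assms] sat_fm_final[OF assms] 1 2
      verify_def ..
qed

lemma sat_fm_problem:
  "sat w (\<lambda>_. 0) (fm_problem c dec) \<longleftrightarrow> verify x (\<lambda>p. bit y (2 * p)) (\<lambda>p. bit y (2 * p + 1))
    (\<lambda>p. fst (dec (block p))) (\<lambda>p. snd (dec (block p)))"
proof -
  let ?e = "\<lambda>a b. (\<lambda>_. 0)(0 := a, 1 := b)"
  let ?a = "2 * length x + 1" and ?b = "2 * length x + 2 * length y + 2"
  have 1: "sat w (?e a b) (fm_end [] 0) \<longleftrightarrow> a = ?a" if "a \<le> Suc (length w)" for a b :: nat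
    using sat_fm_end[of "[]" 0 "?e a b" w "length x"] enc_triple_nth(4)[of _ x y z] that
    by (simp add: length_w) (simp add: w_def)
  have 2: "sat w (?e ?a b) (fm_end [0] 1) \<longleftrightarrow> b = ?b" if "b \<le> Suc (length w)" for b
    using sat_fm_end[of "[0]" 1 "?e ?a b" w "length y"] enc_triple_nth(5)[of _ y x z] that
    by (simp add: length_w) (simp add: w_def)
  have "sat w (\<lambda>_. 0) (fm_problem c dec) \<longleftrightarrow> (\<exists>a \<le> Suc (length w). \<exists>b \<le> Suc (length w).
      sat w (?e a b) (fm_end [] 0) \<and> sat w (?e a b) (fm_end [0] 1) \<and> sat w (?e a b) (fm_verify c dec))"
    unfolding fm_problem_def sat.simps ..
  also have "\<dots> \<longleftrightarrow> sat w (?e ?a ?b) (fm_verify c dec)"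
  proof
    assume "\<exists>a \<le> Suc (length w). \<exists>b \<le> Suc (length w).
      sat w (?e a b) (fm_end [] 0) \<and> sat w (?e a b) (fm_end [0] 1) \<and> sat w (?e a b) (fm_verify c dec)"
    then obtain a b where "a \<le> Suc (length w)" "b \<le> Suc (length w)"
      "sat w (?e a b) (fm_end [] 0)" "sat w (?e a b) (fm_end [0] 1)" "sat w (?e a b) (fm_verify c dec)"
      by blast
    then show "sat w (?e ?a ?b) (fm_verify c dec)" using 1 2 by metis
  next
    have "?a \<le> Suc (length w)" "?b \<le> Suc (length w)" by (simp_all add: length_w)
    moreover assume "sat w (?e ?a ?b) (fm_verify c dec)"
    ultimately show "\<exists>a \<le> Suc (length w). \<exists>b \<le> Suc (length w).
      sat w (?e a b) (fm_end [] 0) \<and> sat w (?e a b) (fm_end [0] 1) \<and> sat w (?e a b) (fm_verify c dec)"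
      using 1 2 by blast
  qed
  also have "\<dots> \<longleftrightarrow> verify x (\<lambda>p. bit y (2 * p)) (\<lambda>p. bit y (2 * p + 1))
      (\<lambda>p. fst (dec (block p))) (\<lambda>p. snd (dec (block p)))"
    by (rule sat_fm_verify) (simp add: frame_def)
  finally show ?thesis .
qed

end

section \<open>Words of polynomial length as certificates\<close>

text \<open>Only the values up to \<open>length x\<close> are inspected, so functions on all
  positions can be replaced by finite words.\<close>

lemma verify_cong:
  assumes "\<And>p. p \<le> length x \<Longrightarrow> i p = i' p" "\<And>p. p \<le> length x \<Longrightarrow> j p = j' p"
    "\<And>p. p \<le> length x \<Longrightarrow> k p = k' p" "\<And>p. p \<le> length x \<Longrightarrow> S p = S' p"
  shows "verify x i j k S \<longleftrightarrow> verify x i' j' k' S'"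
proof -
  have "run_on x (\<lambda>p. (i p, j p, k p)) S \<longleftrightarrow> run_on x (\<lambda>p. (i' p, j' p, k' p)) S'"
    using assms by (simp add: run_on_def Suc_le_eq)
  moreover have "same_atoms_respect x (\<lambda>p. fst (S p)) R \<longleftrightarrow> same_atoms_respect x (\<lambda>p. fst (S' p)) R'"
    if "\<And>p q. p < length x \<Longrightarrow> q < length x \<Longrightarrow> R p q \<longleftrightarrow> R' p q" for R R'
    using that assms by (simp add: same_atoms_respect_def)
  ultimately show ?thesis
    unfolding verify_def using assms by (simp cong: if_cong)
qed

lemma finite_code:
  "\<exists>(code :: 's::finite \<Rightarrow> bool list) n. inj code \<and> (\<forall>s. length (code s) = n)"
proof -
  obtain ss :: "'s list" where ss: "set ss = UNIV" using finite_list[OF finite] by blast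
  have "inj (\<lambda>s. map (\<lambda>t. t = s) ss)"
    using ss by (intro injI) (simp add: map_eq_conv, blast)
  then show ?thesis by (intro exI[of _ "\<lambda>s. map (\<lambda>t. t = s) ss"] exI[of _ "length ss"]) simp
qed

theorem theorem5p5:
  fixes val :: "bool list \<Rightarrow> real"
  shows "semi_uniform_equivalence_problem val \<in> PiP2"
proof -
  obtain code :: "bool \<times> phase \<times> label memory \<Rightarrow> bool list" and c
    where code: "inj code" "\<And>s. length (code s) = c"
    using finite_code by metis
  \<comment> \<open>Blocks that are no codes also decode to some value; this is harmless, since
    \<open>verify\<close> has to hold for all \<open>k\<close> and \<open>S\<close>.\<close>
  define dec where "dec = inv code"
  have dec: "dec (code s) = s" for s
    using code(1) by (simp add: dec_def)
  let ?block = "\<lambda>z p. triple_formulas.block z c p"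
  define V where "V = {w. sat w (\<lambda>_. 0) (fm_problem c dec)}"
  have V: "enc_triple x y z \<in> V \<longleftrightarrow> verify x (\<lambda>p. bit y (2 * p)) (\<lambda>p. bit y (2 * p + 1))
      (\<lambda>p. fst (dec (?block z p))) (\<lambda>p. snd (dec (?block z p)))" for x y z
    using triple_formulas.sat_fm_problem[of x y z c dec] by (simp add: V_def triple_formulas.w_def)
  \<comment> \<open>There are \<open>length x + 1\<close> positions; \<open>y\<close> needs two bits
    for each and \<open>z\<close> needs \<open>c\<close>.\<close>
  let ?q = "[:c + 2, c + 2:] :: nat poly"
  have V_correct: "x \<notin> semi_uniform_equivalence_problem val \<longleftrightarrow> (\<exists>y. length y \<le> poly ?q (length x) \<and>
      (\<forall>z. length z \<le> poly ?q (length x) \<longrightarrow> enc_triple x y z \<in> V))" for x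
    unfolding not_in_problem_iff
  proof
    assume "\<exists>i j. \<forall>k S. verify x i j k S"
    then obtain i j where v: "\<And>k S. verify x i j k S" by blast
    define y where "y = map (\<lambda>m. if even m then i (m div 2) else j (m div 2)) [0..<2 * (length x + 1)]"
    have ij: "i p = bit y (2 * p)" "j p = bit y (2 * p + 1)" if "p \<le> length x" for p
      using that by (simp_all add: y_def bit_def del: upt_Suc)
    have "verify x i j k S \<longleftrightarrow> verify x (\<lambda>p. bit y (2 * p)) (\<lambda>p. bit y (2 * p + 1)) k S" for k S
      by (rule verify_cong) (use ij in simp_all)
    from iffD1[OF this v] have "enc_triple x y z \<in> V" for z unfolding V .
    moreover have "length y \<le> poly ?q (length x)" by (simp add: y_def)
    ultimately show "\<exists>y. length y \<le> poly ?q (length x) \<and>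
      (\<forall>z. length z \<le> poly ?q (length x) \<longrightarrow> enc_triple x y z \<in> V)" by blast
  next
    assume "\<exists>y. length y \<le> poly ?q (length x) \<and>
      (\<forall>z. length z \<le> poly ?q (length x) \<longrightarrow> enc_triple x y z \<in> V)"
    then obtain y where y: "\<And>z. length z \<le> poly ?q (length x) \<Longrightarrow> enc_triple x y z \<in> V" by blast
    have "verify x (\<lambda>p. bit y (2 * p)) (\<lambda>p. bit y (2 * p + 1)) k S" for k S
    proof -
      \<comment> \<open>The concatenated blocks realize arbitrary \<open>k\<close> and
        \<open>S\<close> on all inspected positions.\<close>
      define z where "z = map (\<lambda>m. code (k (m div c), S (m div c)) ! (m mod c)) [0..<c * (length x + 1)]"
      have block: "?block z p = code (k p, S p)" if "p \<le> length x" for p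
      proof (rule nth_equalityI)
        show "length (?block z p) = length (code (k p, S p))"
          by (simp add: code(2) triple_formulas.length_block)
        fix t assume "t < length (?block z p)"
        then have t: "t < c" by (simp add: triple_formulas.length_block)
        have "c * p + t < c * (length x + 1)"
          unfolding distrib_left using t mult_le_mono2[OF that, of c] by linarith
        then show "?block z p ! t = code (k p, S p) ! t"
          using t by (simp add: triple_formulas.block_def bit_def z_def)
      qed
      have "enc_triple x y z \<in> V" by (rule y) (simp add: z_def algebra_simps)
      then show ?thesis
        unfolding V
        by (subst verify_cong[where i' = "\<lambda>p. bit y (2 * p)" and j' = "\<lambda>p. bit y (2 * p + 1)"
              and k' = "\<lambda>p. fst (dec (?block z p))" and S' = "\<lambda>p. snd (dec (?block z p))"])
          (simp_all add: block dec)
    qed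
    then show "\<exists>i j. \<forall>k S. verify x i j k S" by blast
  qed
  have "V \<in> PTIME" unfolding V_def by (rule PTIME_first_order[OF wf_fm_problem])
  have "- semi_uniform_equivalence_problem val \<in> SigmaP2"
    unfolding SigmaP2_def mem_Collect_eq Compl_iff
    by (rule bexI[OF _ \<open>V \<in> PTIME\<close>], rule exI[of _ ?q], rule allI, rule V_correct)
  then show ?thesis by (simp add: PiP2_def)
qed

end
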